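(* Let $G$ be a finite group. Then the following are equivalent: (1) $G$ is a rational group. (2) There exist a nonempty set $I$, a finite geometry $\Gamma = (X, *, t)$ of type $I$, and an action of $G$ on $\Gamma$ as a group of automorphisms (that is, a homomorphism $\theta : G \to \mathrm{Aut}(\Gamma)$) such that, for all $g, h \in G$, if $|\mathrm{Fix}_J(g)| = |\mathrm{Fix}_J(h)|$ for all subsets $J \subseteq I$ (i.e. $g$ and $h$ fix the same number of flags of type $J$ for every $J \subseteq I$), then $g$ and $h$ are conjugate in $G$.
   Context: A finite group $G$ is a rational group if every ordinary (i.e. complex) irreducible character of $G$ is rational-valued. Let $I$ be a nonempty set. A geometry (incidence geometry) of type $I$ is a triple $\Gamma = (X, *, t)$ where $X$ is a nonempty set, $*$ is a symmetric and reflexive relation on $X$ (incidence), and $t : X \to I$ is a function (the type function) such that if $t(x) = t(x')$ and $x * x'$ then $x = x'$. The geometry is finite if $X$ is finite. A flag of $\Gamma$ is a set $F$ of mutually incident elements of $X$, and the type of a flag $F$ is the set $\{t(x) : x \in F\} \subseteq I$. An automorphism of $\Gamma$ is a bijection $\alpha : X \to X$ such that $\alpha$ and $\alpha^{-1}$ preserve incidence and types; $\mathrm{Aut}(\Gamma)$ is the group of all automorphisms of $\Gamma$. A group $G$ acts on $\Gamma$ if there is a homomorphism $\theta : G \to \mathrm{Aut}(\Gamma)$ (not required to be injective). When $G$ acts on $\Gamma$, for $g \in G$ and $J \subseteq I$, $\mathrm{Fix}_J(g)$ denotes the set of flags $F$ of type $J$ fixed by $g$, i.e. with $\theta(g)(F)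 = F$. *)

theory Defs
  imports "HOL-Algebra.Bij" "Jordan_Normal_Form.VS_Connect"
begin

text \<open>The units of the monoid of complex \<open>n \<times> n\<close> matrices form \<open>GL\<^sub>n(\<complex>)\<close>;
  the last argument of \<open>ring_mat\<close> is an irrelevant record extension.\<close>

definition GL_complex :: "nat \<Rightarrow> complex mat monoid" where
  "GL_complex n = units_of (ring_mat TYPE(complex) n ())"

definition complex_rep :: "('g, 'b) monoid_scheme \<Rightarrow> nat \<Rightarrow> ('g \<Rightarrow> complex mat) \<Rightarrow> bool" where
  "complex_rep G n \<rho> \<longleftrightarrow> \<rho> \<in> hom G (GL_complex n)"

definition invariant_subspace ::
  "('g, 'b) monoid_scheme \<Rightarrow> nat \<Rightarrow> ('g \<Rightarrow> complex mat) \<Rightarrow> complex vec set \<Rightarrow> bool" where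
  "invariant_subspace G n \<rho> W \<longleftrightarrow>
     VectorSpace.subspace class_ring W (module_vec TYPE(complex) n) \<and>
     (\<forall>g\<in>carrier G. \<forall>w\<in>W. \<rho> g *\<^sub>v w \<in> W)"

definition irreducible_rep :: "('g, 'b) monoid_scheme \<Rightarrow> nat \<Rightarrow> ('g \<Rightarrow> complex mat) \<Rightarrow> bool" where
  "irreducible_rep G n \<rho> \<longleftrightarrow> complex_rep G n \<rho> \<and> n > 0 \<and>
     (\<forall>W. invariant_subspace G n \<rho> W \<longrightarrow> W = {0\<^sub>v n} \<or> W = carrier_vec n)"

definition mat_trace :: "complex mat \<Rightarrow> complex" where
  "mat_trace A = (\<Sum>i<dim_row A. A $$ (i, i))"

definition irreducible_character :: "('g, 'b) monoid_scheme \<Rightarrow> ('g \<Rightarrow> complex) \<Rightarrow> bool" where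
  "irreducible_character G \<chi> \<longleftrightarrow>
     (\<exists>n \<rho>. irreducible_rep G n \<rho> \<and> \<chi> = (\<lambda>g\<in>carrier G. mat_trace (\<rho> g)))"

definition rational_group :: "('g, 'b) monoid_scheme \<Rightarrow> bool" where
  "rational_group G \<longleftrightarrow>
     (\<forall>\<chi>. irreducible_character G \<chi> \<longrightarrow> (\<forall>g\<in>carrier G. \<chi> g \<in> \<rat>))"

definition conjugate_in :: "('g, 'b) monoid_scheme \<Rightarrow> 'g \<Rightarrow> 'g \<Rightarrow> bool" where
  "conjugate_in G g h \<longleftrightarrow> (\<exists>k\<in>carrier G. h = k \<otimes>\<^bsub>G\<^esub> g \<otimes>\<^bsub>G\<^esub> inv\<^bsub>G\<^esub> k)"

locale geometry =
  fixes I :: "'i set" and X :: "'x set" and inc :: "'x rel" and t :: "'x \<Rightarrow> 'i"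
  assumes types_nonempty: "I \<noteq> {}"
    and elements_nonempty: "X \<noteq> {}"
    and inc_on: "inc \<subseteq> X \<times> X"
    and inc_refl: "refl_on X inc"
    and inc_sym: "sym inc"
    and type_fun: "t \<in> X \<rightarrow> I"
    and type_inj: "\<lbrakk>x \<in> X; x' \<in> X; t x = t x'; (x, x') \<in> inc\<rbrakk> \<Longrightarrow> x = x'"

definition preserves_geometry :: "'x set \<Rightarrow> 'x rel \<Rightarrow> ('x \<Rightarrow> 'i) \<Rightarrow> ('x \<Rightarrow> 'x) \<Rightarrow> bool" where
  "preserves_geometry X inc t \<alpha> \<longleftrightarrow>
     (\<forall>x\<in>X. \<forall>y\<in>X. (x, y) \<in> inc \<longrightarrow> (\<alpha> x, \<alpha> y) \<in> inc) \<and> (\<forall>x\<in>X. t (\<alpha> x) = t x)"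

text \<open>The elements of \<open>Bij X\<close> are extensional, so each automorphism of the geometry is
  represented by exactly one function; \<open>inv_into X \<alpha>\<close> is only ever evaluated on \<open>X\<close>.\<close>

definition Aut_geometry :: "'x set \<Rightarrow> 'x rel \<Rightarrow> ('x \<Rightarrow> 'i) \<Rightarrow> ('x \<Rightarrow> 'x) monoid" where
  "Aut_geometry X inc t = (BijGroup X)
     \<lparr>carrier := {\<alpha> \<in> Bij X. preserves_geometry X inc t \<alpha> \<and>
                              preserves_geometry X inc t (inv_into X \<alpha>)}\<rparr>"

text \<open>The empty set is a flag, of type \<open>{}\<close>.\<close>

definition flag :: "'x set \<Rightarrow> 'x rel \<Rightarrow> 'x set \<Rightarrow> bool" where
  "flag X inc F \<longleftrightarrow> F \<subseteq> X \<and> (\<forall>x\<in>F. \<forall>y\<in>F. (x, y) \<in> inc)"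

definition fixed_flags ::
  "'x set \<Rightarrow> 'x rel \<Rightarrow> ('x \<Rightarrow> 'i) \<Rightarrow> 'i set \<Rightarrow> ('x \<Rightarrow> 'x) \<Rightarrow> 'x set set" where
  "fixed_flags X inc t J \<alpha> = {F. flag X inc F \<and> t ` F = J \<and> \<alpha> ` F = F}"

definition flag_counts_separate_classes ::
  "('g, 'b) monoid_scheme \<Rightarrow> 'i set \<Rightarrow> 'x set \<Rightarrow> 'x rel \<Rightarrow> ('x \<Rightarrow> 'i) \<Rightarrow> ('g \<Rightarrow> 'x \<Rightarrow> 'x) \<Rightarrow> bool" where
  "flag_counts_separate_classes G I X inc t \<theta> \<longleftrightarrow>
     (\<forall>g\<in>carrier G. \<forall>h\<in>carrier G.
        (\<forall>J. J \<subseteq> I \<longrightarrow> card (fixed_flags X inc t J (\<theta> g)) = card (fixed_flags X inc t J (\<theta> h)))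
        \<longrightarrow> conjugate_in G g h)"

end

theory Submission
  imports Defs "Jordan_Normal_Form.Schur_Decomposition" "Jordan_Normal_Form.DL_Rank"
    "HOL-Number_Theory.Number_Theory"
begin

text \<open>\<open>G\<close> is rational iff any two generators of a cyclic subgroup are conjugate. Generators of
  the same subgroup fix the same flags, so a geometry as in (2) makes them conjugate; then
  \<open>\<chi> g = \<chi> (g\<^sup>k)\<close> for all \<open>k\<close> coprime to the order of \<open>g\<close>, and summing over these \<open>k\<close> exhibits a
  multiple of \<open>\<chi> g\<close> as a sum of Ramanujan sums of the eigenvalues.

  Conversely, for \<open>G\<close> rational it is enough to show that \<open>g\<close> is conjugate to \<open>g\<^sup>p\<close> for primes
  \<open>p\<close> not dividing \<open>\<bar>G\<bar>\<close>, since every class coprime to the order of \<open>g\<close> contains a product of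
  such primes. The characters induced from \<open>\<langle>g\<rangle>\<close> take integer values that agree modulo \<open>p\<close> at
  \<open>g\<close> and \<open>g\<^sup>p\<close>; inverting the Fourier transform on \<open>\<langle>g\<rangle>\<close>, the number of \<open>x\<close> with
  \<open>x\<^sup>-\<^sup>1 g\<^sup>p x = g\<close> is congruent modulo \<open>p\<close> to the order of the centralizer of \<open>g\<close>, hence nonzero.

  The separating geometry consists of the cosets of all cyclic subgroups, with no two distinct
  elements incident: if \<open>g\<close> and \<open>h\<close> fix equally many cosets of each type, then \<open>\<langle>g\<rangle>\<close> and \<open>\<langle>h\<rangle>\<close> are
  conjugate.\<close>

section \<open>Traces of matrices of finite order\<close>

lemma mat_trace_mult_comm:
  assumes A: "A \<in> carrier_mat n m" and B: "B \<in> carrier_mat m n"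
  shows "mat_trace (A * B) = mat_trace (B * A)"
proof -
  have "mat_trace (A * B) = (\<Sum>i<n. \<Sum>j<m. A $$ (i, j) * B $$ (j, i))"
    using A B by (auto simp: mat_trace_def scalar_prod_def atLeast0LessThan intro!: sum.cong)
  also have "\<dots> = (\<Sum>j<m. \<Sum>i<n. B $$ (j, i) * A $$ (i, j))"
    by (subst sum.swap) (simp add: mult.commute)
  also have "\<dots> = mat_trace (B * A)"
    using A B by (auto simp: mat_trace_def scalar_prod_def atLeast0LessThan intro!: sum.cong)
  finally show ?thesis .
qed

lemma mat_trace_conjugation:
  assumes "P \<in> carrier_mat n n" "A \<in> carrier_mat n n" "Q \<in> carrier_mat n n" "Q * P = 1\<^sub>m n"
  shows "mat_trace (P * A * Q) = mat_trace A"
proof -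
  have "mat_trace (P * A * Q) = mat_trace (P * (A * Q))"
    using assms by (subst assoc_mult_mat) auto
  also have "\<dots> = mat_trace (A * Q * P)"
    using assms by (intro mat_trace_mult_comm) auto
  also have "A * Q * P = A"
    using assms by (subst assoc_mult_mat) auto
  finally show ?thesis .
qed

lemma upper_triangular_power:
  fixes A :: "'a :: comm_ring_1 mat"
  assumes A: "A \<in> carrier_mat n n" and ut: "upper_triangular A"
  shows "upper_triangular (A ^\<^sub>m k) \<and> (\<forall>i<n. (A ^\<^sub>m k) $$ (i, i) = (A $$ (i, i)) ^ k)"
proof (induction k)
  case 0
  then show ?case using A by auto
next
  case (Suc k)
  let ?B = "A ^\<^sub>m k"
  have B: "?B \<in> carrier_mat n n" using A by simp
  have entry: "(?B * A) $$ (i, j) = (\<Sum>l<n. ?B $$ (i, l) * A $$ (l, j))" if "i < n" "j < n" for i j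
    using A B that by (auto simp: scalar_prod_def atLeast0LessThan)
  have B0: "?B $$ (i, l) = 0" if "l < i" "i < n" for i l
    using Suc B that by auto
  have A0: "A $$ (l, j) = 0" if "j < l" "l < n" for j l
    using ut A that by auto
  have "(?B * A) $$ (i, j) = 0" if "j < i" "i < n" for i j
  proof -
    have "?B $$ (i, l) * A $$ (l, j) = 0" if "l < n" for l
      using B0[of l i] A0[of j l] \<open>j < i\<close> \<open>i < n\<close> that by (cases "l < i") auto
    then show ?thesis using entry[of i j] that by simp
  qed
  moreover have "(?B * A) $$ (i, i) = (A $$ (i, i)) ^ Suc k" if "i < n" for i
  proof -
    have "(\<Sum>l<n. ?B $$ (i, l) * A $$ (l, i)) = (\<Sum>l\<in>{i}. ?B $$ (i, l) * A $$ (l, i))"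
    proof (rule sum.mono_neutral_right)
      show "\<forall>l\<in>{..<n} - {i}. ?B $$ (i, l) * A $$ (l, i) = 0"
        using B0[of _ i] A0[of i] that by (metis DiffD1 DiffD2 insertI1 lessThan_iff linorder_neqE_nat mult_zero_left mult_zero_right)
    qed (use that in auto)
    then show ?thesis using entry[of i i] Suc that by simp
  qed
  ultimately show ?case using A by (auto simp: upper_triangular_def)
qed

text \<open>Schur decomposition makes \<open>A\<close> similar to an upper triangular
  \<open>B\<close>. Powers of \<open>B\<close> have the powers of its diagonal entries on their
  diagonal, so \<open>l\<close> lists these entries: the traces are their power sums, and
  \<open>B ^\<^sub>m m = 1\<^sub>m n\<close> makes each of them a root of unity.\<close>

lemma mat_trace_powers_of_finite_order:
  assumes A: "A \<in> carrier_mat n n" and Am: "A ^\<^sub>m m = 1\<^sub>m n"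
  obtains l :: "nat \<Rightarrow> complex" where "\<And>i. i < n \<Longrightarrow> l i ^ m = 1"
    and "\<And>k. mat_trace (A ^\<^sub>m k) = (\<Sum>i<n. l i ^ k)"
proof -
  obtain es where es: "char_poly A = (\<Prod>a\<leftarrow>es. [:- a, 1:])"
    using char_poly_factorized[OF A] by blast
  obtain B where B: "B \<in> carrier_mat n n" "upper_triangular B" "similar_mat A B"
    using schur_decomposition_exists[OF A es] by blast
  then obtain P Q where wit: "similar_mat_wit A B P Q"
    by (auto simp: similar_mat_def)
  note w = similar_mat_witD2[OF A wit]
  have pow: "A ^\<^sub>m k = P * B ^\<^sub>m k * Q" for k
    using similar_mat_wit_pow_id[OF wit] .
  have tr: "mat_trace (A ^\<^sub>m k) = (\<Sum>i<n. (B $$ (i, i)) ^ k)" for k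
  proof -
    have "mat_trace (A ^\<^sub>m k) = mat_trace (B ^\<^sub>m k)"
      unfolding pow using w by (intro mat_trace_conjugation[where n = n]) auto
    also have "\<dots> = (\<Sum>i<n. (B $$ (i, i)) ^ k)"
      using upper_triangular_power[OF B(1,2), of k] B(1) by (simp add: mat_trace_def)
    finally show ?thesis .
  qed
  have "B ^\<^sub>m m = 1\<^sub>m n"
    using similar_mat_wit_pow_id[OF similar_mat_wit_sym[OF wit], of m] w Am by simp
  then have "(B $$ (i, i)) ^ m = 1" if "i < n" for i
    using upper_triangular_power[OF B(1,2), of m] that by auto
  then show ?thesis using that[of "\<lambda>i. B $$ (i, i)"] tr by blast
qed

lemma sum_root_of_unity_powers:
  fixes z :: "'a :: field"
  assumes "z ^ m = 1"
  shows "(\<Sum>k<m. z ^ k) = (if z = 1 then of_nat m else 0)"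
  using assms by (simp add: geometric_sum)

text \<open>Ramanujan's sums: splitting \<open>k < m\<close> according to \<open>gcd k m\<close> expresses the full geometric
  sum, which is \<open>0\<close> or \<open>m\<close>, through such sums for the divisors of \<open>m\<close>.\<close>

lemma ramanujan_sum_rational:
  fixes z :: complex
  assumes "0 < m" "z ^ m = 1"
  shows "(\<Sum>k | k < m \<and> coprime k m. z ^ k) \<in> \<rat>"
  using assms
proof (induction m arbitrary: z rule: less_induct)
  case (less m)
  define D where "D = {d. d dvd m}"
  define T where "T d = (\<Sum>k | k < m \<and> gcd k m = d. z ^ k)" for d
  have finD: "finite D" using less.prems by (simp add: D_def)
  have "(\<Sum>d\<in>D. T d) = (\<Sum>k<m. z ^ k)"
    unfolding T_def using finD
    by (subst sum.group[symmetric, of _ D "\<lambda>k. gcd k m"]) (auto simp: D_def intro!: sum.cong)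
  also have "\<dots> \<in> \<rat>"
    using sum_root_of_unity_powers[OF less.prems(2)] by simp
  finally have "T 1 + (\<Sum>d\<in>D - {1}. T d) \<in> \<rat>"
    using sum.remove[OF finD, of 1 T] by (simp add: D_def)
  moreover have "(\<Sum>d\<in>D - {1}. T d) \<in> \<rat>"
  proof (rule Rats_sum)
    fix d assume d: "d \<in> D - {1}"
    then obtain e where m: "m = d * e" by (auto simp: D_def)
    have pos: "0 < d" "0 < e" using less.prems m by auto
    have "1 < d" using d pos by (cases "d = 1") auto
    then have "e < m" using m pos by simp
    have gcd_d: "gcd (d * j) m = d * gcd j e" for j
      unfolding m by (rule gcd_mult_distrib_nat[symmetric])
    \<comment> \<open>The \<open>k < m\<close> with \<open>gcd k m = d\<close> are the multiples
      \<open>d * j\<close> with \<open>j < e\<close> coprime to \<open>e\<close>, so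
      \<open>T d\<close> is the Ramanujan sum of the root of unity \<open>z ^ d\<close> for the
      smaller modulus \<open>e\<close>.\<close>
    have "T d = (\<Sum>k | k < e \<and> coprime k e. (z ^ d) ^ k)"
      unfolding T_def
    proof (rule sum.reindex_bij_witness[of _ "\<lambda>k. d * k" "\<lambda>k. k div d"])
      fix k assume k: "k \<in> {k. k < m \<and> gcd k m = d}"
      then have "d dvd k" by auto
      then obtain j where j: "k = d * j" ..
      have "j < e" using k j pos m by simp
      moreover have "d * gcd j e = d * 1"
        using k unfolding gcd_d[symmetric] j[symmetric] by simp
      then have "coprime j e"
        unfolding mult_cancel1 coprime_iff_gcd_eq_1 using pos by simp
      ultimately show "k div d \<in> {k. k < e \<and> coprime k e}" "d * (k div d) = k"
        "(z ^ d) ^ (k div d) = z ^ k"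
        using pos unfolding j by (simp_all add: power_mult)
    next
      fix k assume k: "k \<in> {k. k < e \<and> coprime k e}"
      then show "d * k div d = k" "d * k \<in> {k. k < m \<and> gcd k m = d}"
        using pos by (simp_all add: gcd_d) (simp add: m)
    qed
    also have "\<dots> \<in> \<rat>"
      using less.IH[OF \<open>e < m\<close> pos(2), of "z ^ d"] less.prems m by (simp add: power_mult)
    finally show "T d \<in> \<rat>" .
  qed
  ultimately have "T 1 \<in> \<rat>" by (metis Rats_diff add_diff_cancel_right')
  then show ?case by (simp only: T_def coprime_iff_gcd_eq_1)
qed

lemma sum_mat_trace_coprime_powers_rational:
  assumes "A \<in> carrier_mat n n" "A ^\<^sub>m m = 1\<^sub>m n" "0 < m"
  shows "(\<Sum>k | k < m \<and> coprime k m. mat_trace (A ^\<^sub>m k)) \<in> \<rat>"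
proof -
  obtain l :: "nat \<Rightarrow> complex" where l: "\<And>i. i < n \<Longrightarrow> l i ^ m = 1"
    and tr: "\<And>k. mat_trace (A ^\<^sub>m k) = (\<Sum>i<n. l i ^ k)"
    using mat_trace_powers_of_finite_order[OF assms(1,2)] by blast
  have "(\<Sum>k | k < m \<and> coprime k m. mat_trace (A ^\<^sub>m k))
      = (\<Sum>i<n. \<Sum>k | k < m \<and> coprime k m. l i ^ k)"
    unfolding tr by (rule sum.swap)
  also have "\<dots> \<in> \<rat>"
    by (rule Rats_sum, rule ramanujan_sum_rational[OF assms(3) l]) simp
  finally show ?thesis .
qed

section \<open>Congruences in the integers adjoined a root of unity\<close>

definition int_adjoin :: "'a :: comm_ring_1 \<Rightarrow> 'a set" where
  "int_adjoin z = range (\<lambda>p. poly (of_int_poly p) z)"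

lemma int_adjoin_of_int [simp]: "of_int a \<in> int_adjoin z"
  unfolding int_adjoin_def by (rule range_eqI[of _ _ "[:a:]"]) (simp add: of_int_hom.map_poly_pCons_hom)

lemma int_adjoin_add: "x \<in> int_adjoin z \<Longrightarrow> y \<in> int_adjoin z \<Longrightarrow> x + y \<in> int_adjoin z"
  unfolding int_adjoin_def
  by (elim rangeE, rule range_eqI[of _ _ "_ + _"]) (simp add: of_int_poly_hom.hom_add)

lemma int_adjoin_mult: "x \<in> int_adjoin z \<Longrightarrow> y \<in> int_adjoin z \<Longrightarrow> x * y \<in> int_adjoin z"
  unfolding int_adjoin_def
  by (elim rangeE, rule range_eqI[of _ _ "_ * _"]) (simp add: of_int_poly_hom.hom_mult)

lemma int_adjoin_minus: "x \<in> int_adjoin z \<Longrightarrow> - x \<in> int_adjoin z"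
  using int_adjoin_mult[of "of_int (- 1)" z x] int_adjoin_of_int[of "- 1" z] by simp

lemma int_adjoin_diff: "x \<in> int_adjoin z \<Longrightarrow> y \<in> int_adjoin z \<Longrightarrow> x - y \<in> int_adjoin z"
  using int_adjoin_add[of x z "- y"] int_adjoin_minus[of y z] by simp

lemma int_adjoin_generator [simp]: "z \<in> int_adjoin z"
  unfolding int_adjoin_def by (rule range_eqI[of _ _ "[:0, 1:]"]) (simp add: of_int_hom.map_poly_pCons_hom)

lemma int_adjoin_power: "x \<in> int_adjoin z \<Longrightarrow> x ^ k \<in> int_adjoin z"
  by (induction k) (use int_adjoin_of_int[of 1 z] in \<open>simp_all add: int_adjoin_mult\<close>)

lemma int_adjoin_sum: "(\<And>i. i \<in> A \<Longrightarrow> f i \<in> int_adjoin z) \<Longrightarrow> sum f A \<in> int_adjoin z"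
  by (induction A rule: infinite_finite_induct)
    (use int_adjoin_of_int[of 0 z] in \<open>simp_all add: int_adjoin_add\<close>)

text \<open>Multiplication by an element of \<open>\<int>[z]\<close> acts on the spanning family \<open>1, z, \<dots>, z\<^sup>m\<^sup>-\<^sup>1\<close>
  through an integer matrix, of which the element is therefore an eigenvalue.\<close>

lemma int_adjoin_root_of_unity_algebraic_int:
  fixes z :: "'a :: field_char_0"
  assumes z: "z ^ m = 1" "0 < m" and x: "x \<in> int_adjoin z"
  shows "algebraic_int x"
proof -
  obtain p where p: "x = poly (of_int_poly p) z"
    using x by (auto simp: int_adjoin_def)
  \<comment> \<open>Row \<open>r\<close> expands \<open>x * z ^ r\<close> in powers of
    \<open>z\<close>, with exponents reduced modulo \<open>m\<close>.\<close>
  define A :: "int mat"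
    where "A = mat m m (\<lambda>(r, s). \<Sum>i | i \<le> degree p \<and> (i + r) mod m = s. Polynomial.coeff p i)"
  define B :: "'a mat" where "B = map_mat of_int A"
  define v where "v = vec m (\<lambda>s. z ^ s)"
  have A: "A \<in> carrier_mat m m" and B: "B \<in> carrier_mat m m"
    by (simp_all add: A_def B_def)
  have zmod: "z ^ (k mod m) = z ^ k" for k
  proof -
    have "z ^ k = z ^ (m * (k div m) + k mod m)" by simp
    then show ?thesis by (simp only: power_add power_mult z power_one mult_1_left)
  qed
  have "B *\<^sub>v v = x \<cdot>\<^sub>v v"
  proof (rule eq_vecI)
    fix r assume "r < dim_vec (x \<cdot>\<^sub>v v)"
    then have r: "r < m" by (simp add: v_def)
    then have "(B *\<^sub>v v) $ r
        = (\<Sum>s<m. (\<Sum>i | i \<le> degree p \<and> (i + r) mod m = s. of_int (Polynomial.coeff p i)) * z ^ s)"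
      by (auto simp: B_def A_def v_def scalar_prod_def atLeast0LessThan intro!: sum.cong)
    also have "\<dots> = (\<Sum>s<m. \<Sum>i | i \<in> {..degree p} \<and> (i + r) mod m = s. of_int (Polynomial.coeff p i) * z ^ (i + r))"
      unfolding sum_distrib_right by (intro sum.cong) (auto simp: zmod)
    also have "\<dots> = (\<Sum>i\<le>degree p. of_int (Polynomial.coeff p i) * z ^ (i + r))"
      using z by (intro sum.group) auto
    also have "\<dots> = x * z ^ r"
      unfolding p by (simp add: poly_altdef sum_distrib_right power_add mult.assoc)
    finally show "(B *\<^sub>v v) $ r = (x \<cdot>\<^sub>v v) $ r" using r by (simp add: v_def)
  qed (use B in \<open>simp add: v_def\<close>)
  \<comment> \<open>The powers of \<open>z\<close> may be linearly dependent, but an eigenvector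
    only has to be nonzero, and the entry of \<open>v\<close> at 0 is 1.\<close>
  moreover have "v \<noteq> 0\<^sub>v m"
  proof
    assume "v = 0\<^sub>v m"
    then have "v $ 0 = 0\<^sub>v m $ 0" by simp
    then show False using z by (simp add: v_def)
  qed
  ultimately have "eigenvalue B x"
    unfolding eigenvalue_def eigenvector_def using B by (intro exI[of _ v]) (auto simp: v_def)
  then have "poly (of_int_poly (char_poly A)) x = 0"
    unfolding eigenvalue_root_char_poly[OF B] unfolding B_def of_int_hom.char_poly_hom[OF A] .
  then show ?thesis
    unfolding algebraic_int_altdef_ipoly
    by (intro exI[of _ "char_poly A"] conjI) (use degree_monic_char_poly[OF A] in simp_all)
qed

text \<open>This brings congruences back to \<int>: if two integers differ by \<open>p\<close> times
  an element of \<int>[z], that element is rational, being their difference divided by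
  \<open>p\<close>, and hence an integer.\<close>

lemma int_adjoin_root_of_unity_Rats_imp_Ints:
  fixes z :: "'a :: field_char_0"
  assumes "z ^ m = 1" "0 < m" "x \<in> int_adjoin z" "x \<in> \<rat>"
  shows "x \<in> \<int>"
  using int_adjoin_root_of_unity_algebraic_int[OF assms(1-3)] assms(4)
  by (rule rational_algebraic_int_is_int)

text \<open>The prime \<open>p\<close> divides \<open>p choose k\<close> for
  \<open>0 < k < p\<close>; \<open>b\<close> collects the interior terms of the binomial expansion
  after this exact division.\<close>

lemma prime_power_add_int_adjoin:
  assumes p: "prime p" and x: "x \<in> int_adjoin z" and y: "y \<in> int_adjoin z"
  shows "\<exists>b\<in>int_adjoin z. (x + y) ^ p = x ^ p + y ^ p + of_nat p * b"
proof -
  define b where "b = (\<Sum>k\<in>{0<..<p}. of_int (int ((p choose k) div p)) * (x ^ k * y ^ (p - k)))"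
  have split: "{..p} = insert 0 (insert p {0<..<p})" by auto
  have "of_nat (p choose k) * x ^ k * y ^ (p - k)
      = of_nat p * (of_int (int ((p choose k) div p)) * (x ^ k * y ^ (p - k)))"
    if "k \<in> {0<..<p}" for k
  proof -
    have "p dvd p choose k" using p that by (intro dvd_choose_prime) auto
    then obtain c where "p choose k = p * c" ..
    then show ?thesis using prime_gt_0_nat[OF p] by (simp add: mult.assoc)
  qed
  then have "(\<Sum>k\<in>{0<..<p}. of_nat (p choose k) * x ^ k * y ^ (p - k)) = of_nat p * b"
    unfolding b_def sum_distrib_left by (rule sum.cong[OF refl])
  then have "(x + y) ^ p = x ^ p + y ^ p + of_nat p * b"
    using prime_gt_0_nat[OF p] by (simp add: binomial_ring split)
  moreover have "b \<in> int_adjoin z"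
    unfolding b_def using x y
    by (intro int_adjoin_sum int_adjoin_mult int_adjoin_power int_adjoin_of_int)
  ultimately show ?thesis by blast
qed

lemma prime_power_sum_int_adjoin:
  fixes z :: "'a :: comm_ring_1"
  assumes p: "prime p" and f: "\<And>i. i \<in> A \<Longrightarrow> f i \<in> int_adjoin z"
  shows "\<exists>b\<in>int_adjoin z. (\<Sum>i\<in>A. f i) ^ p = (\<Sum>i\<in>A. f i ^ p) + of_nat p * b"
  using f
proof (induction A rule: infinite_finite_induct)
  case (insert i A)
  then obtain b where b: "b \<in> int_adjoin z" "sum f A ^ p = (\<Sum>i\<in>A. f i ^ p) + of_nat p * b"
    by auto
  obtain c where c: "c \<in> int_adjoin z"
      "(f i + sum f A) ^ p = f i ^ p + sum f A ^ p + of_nat p * c"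
    using prime_power_add_int_adjoin[OF p, of "f i" z "sum f A"] insert.prems int_adjoin_sum[of A f z]
    by auto
  have "sum f (insert i A) ^ p = (\<Sum>i\<in>insert i A. f i ^ p) + of_nat p * (b + c)"
    using insert.hyps b c by (simp add: algebra_simps)
  then show ?case using int_adjoin_add[OF b(1) c(1)] by blast
next
  case empty
  have "(0 :: 'a) \<in> int_adjoin z" using int_adjoin_of_int[of 0 z] by simp
  then show ?case using prime_gt_0_nat[OF p] by (intro bexI[of _ 0]) (simp_all add: zero_power)
next
  \<comment> \<open>A sum over an infinite set is 0 by convention, so the case reduces to
    \<open>0 ^ p = 0\<close>.\<close>
  case (infinite A)
  have "(0 :: 'a) \<in> int_adjoin z" using int_adjoin_of_int[of 0 z] by simp
  then show ?case using prime_gt_0_nat[OF p] infinite.hyps by (intro bexI[of _ 0]) (simp_all add: zero_power)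
qed

section \<open>Characters of arbitrary representations\<close>

text \<open>A homomorphism into the unit group sends \<open>\<one>\<close> to an invertible
  idempotent, which is the identity matrix. Conversely, \<open>\<rho> (inv g)\<close> inverts
  \<open>\<rho> g\<close>, so invertibility can be replaced by the condition on
  \<open>\<one>\<close>.\<close>

lemma (in group) complex_rep_iff:
  "complex_rep G n \<rho> \<longleftrightarrow>
    (\<forall>g\<in>carrier G. \<rho> g \<in> carrier_mat n n) \<and> \<rho> \<one> = 1\<^sub>m n \<and>
    (\<forall>g\<in>carrier G. \<forall>h\<in>carrier G. \<rho> (g \<otimes> h) = \<rho> g * \<rho> h)"
    (is "_ \<longleftrightarrow> ?R")
proof -
  note GL = complex_rep_def hom_def GL_complex_def units_of_def Units_def ring_mat_simps
  show ?thesis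
  proof
    assume rep: "complex_rep G n \<rho>"
    then have c: "\<rho> g \<in> carrier_mat n n" if "g \<in> carrier G" for g
      using that by (auto simp: GL)
    have m: "\<rho> (g \<otimes> h) = \<rho> g * \<rho> h" if "g \<in> carrier G" "h \<in> carrier G" for g h
      using rep that by (auto simp: GL)
    obtain B where B: "B \<in> carrier_mat n n" "B * \<rho> \<one> = 1\<^sub>m n"
      using rep by (auto simp: GL)
    have "\<rho> \<one> = (B * \<rho> \<one>) * \<rho> \<one>" using B c[of \<one>] by simp
    also have "\<dots> = B * (\<rho> \<one> * \<rho> \<one>)" using B c[of \<one>] by (intro assoc_mult_mat) auto
    also have "\<dots> = 1\<^sub>m n" using m[of \<one> \<one>] B by simp
    finally show ?R using c m by blast
  next
    assume R: ?R
    have "\<exists>B\<in>carrier_mat n n. \<rho> g * B = 1\<^sub>m n \<and> B * \<rho> g = 1\<^sub>m n" if "g \<in> carrier G" for g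
    proof (intro bexI conjI)
      show "\<rho> g * \<rho> (inv g) = 1\<^sub>m n" using R that by (metis inv_closed r_inv)
      show "\<rho> (inv g) * \<rho> g = 1\<^sub>m n" using R that by (metis inv_closed l_inv)
    qed (use R that in simp)
    then show "complex_rep G n \<rho>"
      using R by (simp add: GL Pi_iff conj_commute)
  qed
qed

section \<open>Bases adapted to a subspace\<close>

context vec_space
begin

text \<open>A maximal independent subset \<open>S\<close> of \<open>W\<close> is extended to a
  maximal independent set \<open>T\<close> of the whole space. The columns of \<open>P\<close> list
  \<open>T\<close> with the \<open>k\<close> elements of \<open>S\<close> first, and
  \<open>Q\<close> computes coordinates; those beyond \<open>k\<close> vanish on \<open>W\<close>
  because \<open>S\<close> spans \<open>W\<close>. In this basis a matrix preserving
  \<open>W\<close> becomes block triangular.\<close>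

lemma adapted_basis:
  assumes W: "VectorSpace.subspace class_ring W V"
    and nonzero: "W \<noteq> {0\<^sub>v n}" and proper: "W \<noteq> carrier_vec n"
  obtains k P Q where "0 < k" "k < n" "P \<in> carrier_mat n n" "Q \<in> carrier_mat n n"
    "P * Q = 1\<^sub>m n" "Q * P = 1\<^sub>m n" "\<And>j. j < k \<Longrightarrow> col P j \<in> W"
    "\<And>w i. \<lbrakk>w \<in> W; k \<le> i; i < n\<rbrakk> \<Longrightarrow> (Q *\<^sub>v w) $ i = 0"
proof -
  have subm: "submodule class_ring W V" using W by (rule is_module)
  have WV: "W \<subseteq> carrier_vec n" using submodule.subset[OF subm] by simp
  have zero_W: "0\<^sub>v n \<in> W" using submodule.zero_closed[OF subm] by simp
  have bound: "finite A \<and> card A \<le> n" if "A \<subseteq> carrier_vec n" "lin_indpt A" for A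
    using li_le_dim[OF fin_dim] that dim_is_n by simp
  have "\<exists>S. finite S \<and> maximal S (\<lambda>S. S \<subseteq> W \<and> lin_indpt S)"
    using WV by (intro maximal_exists[where B = "{}" and N = n] bound) (auto simp: lin_dep_def)
  then obtain S where finS: "finite S" and SW: "S \<subseteq> W" and liS: "lin_indpt S"
    and maxS: "\<And>T. S \<subseteq> T \<Longrightarrow> T \<subseteq> W \<Longrightarrow> lin_indpt T \<Longrightarrow> T = S"
    by (auto simp: maximal_def)
  have SV: "S \<subseteq> carrier_vec n" using SW WV by blast
  have W_span: "w \<in> span S" if "w \<in> W" for w
  proof (cases "w \<in> S")
    case True
    then show ?thesis using in_own_span[of S] SV by auto
  next
    case False
    then have "lin_dep (S \<union> {w})" using maxS[of "S \<union> {w}"] SW that by auto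
    then show ?thesis using lin_dep_iff_in_span[of S w] SV liS False that WV by auto
  qed
  have "\<exists>T. finite T \<and> maximal T (\<lambda>T. S \<subseteq> T \<and> T \<subseteq> carrier_vec n \<and> lin_indpt T)"
    using SV liS by (intro maximal_exists[where B = S and N = n] bound) auto
  then obtain T where finT: "finite T"
    and maxT: "maximal T (\<lambda>T. S \<subseteq> T \<and> T \<subseteq> carrier_vec n \<and> lin_indpt T)"
    by blast
  then have ST: "S \<subseteq> T" and TV: "T \<subseteq> carrier_vec n" and liT: "lin_indpt T"
    by (simp_all add: maximal_def)
  have "maximal T (\<lambda>T. T \<subseteq> carrier_vec n \<and> lin_indpt T)"
    unfolding maximal_def
  proof (intro conjI allI impI TV liT)
    fix B assume "B \<supseteq> T \<and> B \<subseteq> carrier_vec n \<and> lin_indpt B"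
    then show "B = T" using maxT ST unfolding maximal_def by blast
  qed
  then have basisT: "basis T" by (intro max_li_is_basis) simp
  then have cardT: "card T = n" using dim_basis[OF finT basisT] dim_is_n by simp
  obtain ss where ss: "set ss = S" "distinct ss" using finite_distinct_list[OF finS] by blast
  obtain ts where ts: "set ts = T - S" "distinct ts" using finite_distinct_list[of "T - S"] finT by blast
  define us where "us = ss @ ts"
  define k where "k = card S"
  have us: "set us = T" "distinct us" using ss ts ST by (auto simp: us_def)
  have len: "length us = n" using us cardT by (metis distinct_card)
  have len_ss: "length ss = k" using ss by (metis distinct_card k_def)
  define P where "P = mat_of_cols n us"
  have P: "P \<in> carrier_mat n n" using mat_of_cols_carrier(1)[of n us] unfolding len P_def .
  have cols: "cols P = us" using us TV by (simp add: P_def)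
  have col: "col P j = us ! j" if "j < n" for j
    using cols_nth[of j P] P that by (simp add: cols)
  have "rank P = n" using lin_indpt_full_rank[OF P] us liT by (simp add: cols)
  then have "det P \<noteq> 0" using det_rank_iff[OF P] by simp
  then obtain Q where Q: "Q \<in> carrier_mat n n" "P * Q = 1\<^sub>m n" "Q * P = 1\<^sub>m n"
    using det_non_zero_imp_unit[OF P, of "()"] by (auto simp: Units_def ring_mat_simps)
  have col_in: "col P j \<in> S \<longleftrightarrow> j < k" if "j < n" for j
  proof (cases "j < k")
    case True
    then have "us ! j = ss ! j" by (simp add: us_def nth_append len_ss)
    then show ?thesis using True that ss len_ss by (auto simp: col)
  next
    case False
    then have "us ! j = ts ! (j - k)" "j - k < length ts"
      using that len len_ss by (auto simp: us_def nth_append)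
    then have "us ! j \<in> T - S" using ts by (metis nth_mem)
    then show ?thesis using False that by (simp add: col)
  qed
  have coords: "(Q *\<^sub>v w) $ i = 0" if w: "w \<in> W" and i: "k \<le> i" "i < n" for w i
  proof -
    obtain a where a: "w = lincomb a S"
      using W_span[OF w] finite_span[OF finS] SV by auto
    \<comment> \<open>Extending the coefficients by 0 from \<open>S\<close> to \<open>T\<close>
      turns the combination into a product of \<open>P\<close> with a coordinate vector that
      vanishes from position \<open>k\<close> on.\<close>
    define b where "b = (\<lambda>x. if x \<in> S then a x else 0)"
    have "w = lincomb b S" unfolding a by (rule lincomb_cong) (use SV in \<open>auto simp: b_def\<close>)
    also have "\<dots> = lincomb b (S \<union> (T - S))"
      using SV TV finS finT by (intro lincomb_clean[symmetric]) (auto simp: b_def)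
    also have "S \<union> (T - S) = set (cols P)" using ST us cols by auto
    also have "lincomb b (set (cols P)) = P *\<^sub>v vec n (\<lambda>i. b (col P i))"
      using mat_mult_eq_lincomb[OF P] us by (simp add: cols)
    finally have "Q *\<^sub>v w = (Q * P) *\<^sub>v vec n (\<lambda>i. b (col P i))"
      by (simp only: assoc_mult_mat_vec[OF Q(1) P vec_carrier])
    then show ?thesis using i col_in[of i] Q by (simp add: b_def)
  qed
  have k_pos: "0 < k"
  proof (rule ccontr)
    assume "\<not> 0 < k"
    then have "S = {}" using finS by (simp add: k_def)
    then have "W \<subseteq> {0\<^sub>v n}" using W_span span_empty by auto
    then show False using zero_W nonzero by auto
  qed
  have k_less: "k < n"
  proof (rule ccontr)
    assume "\<not> k < n"
    then have "S = T" using card_seteq[OF finT ST] cardT by (simp add: k_def)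
    then have "carrier_vec n = span S" using basisT by (simp add: basis_def)
    also have "\<dots> \<subseteq> W" using span_is_subset[OF SW subm] .
    finally show False using WV proper by blast
  qed
  have "col P j \<in> W" if "j < k" for j
    using col_in[of j] SW that k_less by auto
  then show ?thesis by (rule that[OF k_pos k_less P Q _ coords])
qed

end

section \<open>Block triangular matrices\<close>

definition leading_block :: "nat \<Rightarrow> 'a mat \<Rightarrow> 'a mat" where
  "leading_block k A = mat k k (\<lambda>(i, j). A $$ (i, j))"

definition trailing_block :: "nat \<Rightarrow> 'a mat \<Rightarrow> 'a mat" where
  "trailing_block k A = mat (dim_row A - k) (dim_row A - k) (\<lambda>(i, j). A $$ (k + i, k + j))"

lemma leading_block_carrier [simp]: "leading_block k A \<in> carrier_mat k k"
  by (simp add: leading_block_def)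

lemma trailing_block_carrier: "A \<in> carrier_mat n n \<Longrightarrow> trailing_block k A \<in> carrier_mat (n - k) (n - k)"
  by (simp add: trailing_block_def)

definition block_triangular :: "nat \<Rightarrow> 'a :: zero mat \<Rightarrow> bool" where
  "block_triangular k A \<longleftrightarrow> (\<forall>i j. k \<le> i \<longrightarrow> i < dim_row A \<longrightarrow> j < k \<longrightarrow> A $$ (i, j) = 0)"

lemma sum_split_at:
  fixes f :: "nat \<Rightarrow> 'a :: comm_monoid_add"
  assumes "k \<le> n"
  shows "(\<Sum>i<n. f i) = (\<Sum>i<k. f i) + (\<Sum>i<n - k. f (k + i))"
proof -
  obtain m where "n = k + m" using assms le_Suc_ex by blast
  moreover have "(\<Sum>i<k + m. f i) = (\<Sum>i<k. f i) + (\<Sum>i<m. f (k + i))"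
    by (induction m) (simp_all add: add.assoc)
  ultimately show ?thesis by simp
qed

text \<open>Splitting the inner sum of the product at \<open>k\<close> leaves one unwanted part for
  each diagonal block, and every term of it has a factor from a vanishing lower left block.\<close>

lemma block_triangular_mult:
  assumes A: "A \<in> carrier_mat n n" and B: "B \<in> carrier_mat n n" and k: "k \<le> n"
    and tB: "block_triangular k B"
  shows "leading_block k (A * B) = leading_block k A * leading_block k B"
    and "block_triangular k A \<Longrightarrow> trailing_block k (A * B) = trailing_block k A * trailing_block k B"
proof -
  have entry: "(A * B) $$ (i, j) = (\<Sum>l<k. A $$ (i, l) * B $$ (l, j))
      + (\<Sum>l<n - k. A $$ (i, k + l) * B $$ (k + l, j))" if "i < n" "j < n" for i j
    using A B that sum_split_at[OF k, of "\<lambda>l. A $$ (i, l) * B $$ (l, j)"]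
    by (auto simp: scalar_prod_def atLeast0LessThan)
  show "leading_block k (A * B) = leading_block k A * leading_block k B"
  proof (rule eq_matI)
    fix i j assume "i < dim_row (leading_block k A * leading_block k B)"
      "j < dim_col (leading_block k A * leading_block k B)"
    then have ij: "i < k" "j < k" by (simp_all add: leading_block_def)
    have "(\<Sum>l<n - k. A $$ (i, k + l) * B $$ (k + l, j)) = 0"
      using tB B ij by (intro sum.neutral) (auto simp: block_triangular_def)
    then show "leading_block k (A * B) $$ (i, j) = (leading_block k A * leading_block k B) $$ (i, j)"
      using entry[of i j] ij k by (simp add: leading_block_def scalar_prod_def atLeast0LessThan)
  qed (simp_all add: leading_block_def)
  assume tA: "block_triangular k A"
  show "trailing_block k (A * B) = trailing_block k A * trailing_block k B"
  proof (rule eq_matI)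
    fix i j assume "i < dim_row (trailing_block k A * trailing_block k B)"
      "j < dim_col (trailing_block k A * trailing_block k B)"
    then have ij: "i < n - k" "j < n - k" using A B by (simp_all add: trailing_block_def)
    have "(\<Sum>l<k. A $$ (k + i, l) * B $$ (l, k + j)) = 0"
      using tA A ij by (intro sum.neutral) (auto simp: block_triangular_def)
    then show "trailing_block k (A * B) $$ (i, j) = (trailing_block k A * trailing_block k B) $$ (i, j)"
      using entry[of "k + i" "k + j"] ij A B
      by (simp add: trailing_block_def scalar_prod_def atLeast0LessThan)
  qed (use A B in \<open>simp_all add: trailing_block_def\<close>)
qed

lemma mat_trace_blocks:
  assumes "A \<in> carrier_mat n n" "k \<le> n"
  shows "mat_trace A = mat_trace (leading_block k A) + mat_trace (trailing_block k A)"
  using assms sum_split_at[OF assms(2), of "\<lambda>i. A $$ (i, i)"]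
  by (simp add: mat_trace_def leading_block_def trailing_block_def)

text \<open>In a basis adapted to \<open>W\<close> all matrices are block triangular. The leading
  blocks give the representation on \<open>W\<close>, the trailing blocks the one on the quotient by
  \<open>W\<close>, and the change of basis preserves traces.\<close>

lemma (in group) reducible_rep_trace:
  assumes rep: "complex_rep G n \<rho>" and W: "invariant_subspace G n \<rho> W"
    and nontrivial: "W \<noteq> {0\<^sub>v n}" "W \<noteq> carrier_vec n"
  obtains k \<rho>1 \<rho>2 where "0 < k" "k < n" "complex_rep G k \<rho>1" "complex_rep G (n - k) \<rho>2"
    "\<And>g. g \<in> carrier G \<Longrightarrow> mat_trace (\<rho> g) = mat_trace (\<rho>1 g) + mat_trace (\<rho>2 g)"
proof -
  interpret vec_space "TYPE(complex)" n .
  have "VectorSpace.subspace class_ring W (module_vec TYPE(complex) n)"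
    using W by (simp add: invariant_subspace_def)
  then obtain k P Q where k: "0 < k" "k < n" and P: "P \<in> carrier_mat n n"
    and Q: "Q \<in> carrier_mat n n" and PQ: "P * Q = 1\<^sub>m n" "Q * P = 1\<^sub>m n"
    and colP: "\<And>j. j < k \<Longrightarrow> col P j \<in> W"
    and coords: "\<And>w i. \<lbrakk>w \<in> W; k \<le> i; i < n\<rbrakk> \<Longrightarrow> (Q *\<^sub>v w) $ i = 0"
    using adapted_basis[of W] nontrivial by metis
  define \<sigma> where "\<sigma> g = Q * \<rho> g * P" for g
  have \<rho>: "\<rho> g \<in> carrier_mat n n" if "g \<in> carrier G" for g
    using rep that by (simp add: complex_rep_iff)
  have \<sigma>: "\<sigma> g \<in> carrier_mat n n" if "g \<in> carrier G" for g
    using \<rho>[OF that] P Q by (simp add: \<sigma>_def)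
  have \<sigma>_one: "\<sigma> \<one> = 1\<^sub>m n"
    using rep P Q PQ by (simp add: \<sigma>_def complex_rep_iff)
  have \<sigma>_mult: "\<sigma> (g \<otimes> h) = \<sigma> g * \<sigma> h" if "g \<in> carrier G" "h \<in> carrier G" for g h
  proof -
    note c = \<rho>[OF that(1)] \<rho>[OF that(2)]
    have "\<sigma> g * \<sigma> h = Q * \<rho> g * (P * (Q * \<rho> h * P))"
      unfolding \<sigma>_def using c P Q by (intro assoc_mult_mat) auto
    also have "P * (Q * \<rho> h * P) = (P * Q) * (\<rho> h * P)"
      using c P Q by (simp add: assoc_mult_mat[of _ n n _ n _ n])
    also have "Q * \<rho> g * (P * Q * (\<rho> h * P)) = Q * (\<rho> g * \<rho> h) * P"
      using c P Q PQ by (simp add: assoc_mult_mat[of _ n n _ n _ n])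
    finally show ?thesis
      using rep that by (simp add: \<sigma>_def complex_rep_iff)
  qed
  have tri: "block_triangular k (\<sigma> g)" if g: "g \<in> carrier G" for g
    unfolding block_triangular_def
  proof (intro allI impI)
    fix i j assume i: "k \<le> i" "i < dim_row (\<sigma> g)" and j: "j < k"
    have "\<rho> g *\<^sub>v col P j \<in> W"
      using W g colP[OF j] by (simp add: invariant_subspace_def)
    then have "(Q *\<^sub>v (\<rho> g *\<^sub>v col P j)) $ i = 0"
      using coords i \<sigma>[OF g] by auto
    moreover have "\<sigma> g $$ (i, j) = col (\<sigma> g) j $ i"
      using i j k \<sigma>[OF g] by auto
    moreover have "col (\<sigma> g) j = Q *\<^sub>v (\<rho> g *\<^sub>v col P j)"
    proof -
      have "\<sigma> g = Q * (\<rho> g * P)"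
        unfolding \<sigma>_def using \<rho>[OF g] P Q by (intro assoc_mult_mat) auto
      moreover have "col (Q * (\<rho> g * P)) j = Q *\<^sub>v col (\<rho> g * P) j"
        by (rule col_mult2[of _ n n _ n]) (use \<rho>[OF g] P Q j k in auto)
      moreover have "col (\<rho> g * P) j = \<rho> g *\<^sub>v col P j"
        by (rule col_mult2[of _ n n _ n]) (use \<rho>[OF g] P j k in auto)
      ultimately show ?thesis by simp
    qed
    ultimately show "\<sigma> g $$ (i, j) = 0" by simp
  qed
  have blocks_one: "leading_block k (1\<^sub>m n) = (1\<^sub>m k :: complex mat)"
    "trailing_block k (1\<^sub>m n) = (1\<^sub>m (n - k) :: complex mat)"
    using k by (auto simp: leading_block_def trailing_block_def)
  have "complex_rep G k (\<lambda>g. leading_block k (\<sigma> g))"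
    using \<sigma>_mult \<sigma>_one tri k block_triangular_mult(1)[OF \<sigma> \<sigma>]
    by (auto simp: complex_rep_iff blocks_one)
  moreover have "complex_rep G (n - k) (\<lambda>g. trailing_block k (\<sigma> g))"
    using \<sigma>_mult \<sigma>_one tri k block_triangular_mult(2)[OF \<sigma> \<sigma>]
    by (auto simp: complex_rep_iff blocks_one intro: trailing_block_carrier \<sigma>)
  moreover have "mat_trace (\<rho> g) = mat_trace (leading_block k (\<sigma> g)) + mat_trace (trailing_block k (\<sigma> g))"
    if g: "g \<in> carrier G" for g
  proof -
    have "mat_trace (\<sigma> g) = mat_trace (P * (Q * \<rho> g))"
      unfolding \<sigma>_def using \<rho>[OF g] P Q by (intro mat_trace_mult_comm) auto
    also have "P * (Q * \<rho> g) = \<rho> g"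
      using \<rho>[OF g] P Q PQ by (simp add: assoc_mult_mat[of _ n n _ n _ n, symmetric])
    finally show ?thesis using mat_trace_blocks[OF \<sigma>[OF g], of k] k by simp
  qed
  ultimately show ?thesis using that k by blast
qed

text \<open>Strong induction on the degree: the trace of a reducible representation is a sum of
  traces of representations of smaller positive degree, down to the irreducible ones.\<close>

lemma (in group) rational_group_imp_trace_rational:
  assumes rat: "rational_group G" and "complex_rep G n \<rho>" "g \<in> carrier G"
  shows "mat_trace (\<rho> g) \<in> \<rat>"
  using assms(2)
proof (induction n arbitrary: \<rho> rule: less_induct)
  case (less n)
  consider "n = 0" | "irreducible_rep G n \<rho>"
    | W where "n > 0" "invariant_subspace G n \<rho> W" "W \<noteq> {0\<^sub>v n}" "W \<noteq> carrier_vec n"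
    using less.prems by (auto simp: irreducible_rep_def)
  then show ?case
  proof cases
    \<comment> \<open>Degree 0 does not count as irreducible; its trace is an empty sum.\<close>
    case 1
    then have "\<rho> g \<in> carrier_mat 0 0"
      using less.prems assms(3) by (simp add: complex_rep_iff)
    then show ?thesis by (simp add: mat_trace_def)
  next
    case 2
    then have "irreducible_character G (\<lambda>g\<in>carrier G. mat_trace (\<rho> g))"
      by (auto simp: irreducible_character_def)
    then have "(\<lambda>g\<in>carrier G. mat_trace (\<rho> g)) g \<in> \<rat>"
      using rat assms(3) by (simp only: rational_group_def)
    then show ?thesis using assms(3) by simp
  next
    case 3
    then obtain k \<rho>1 \<rho>2 where k: "0 < k" "k < n" "complex_rep G k \<rho>1" "complex_rep G (n - k) \<rho>2"
      and tr: "\<And>g. g \<in> carrier G \<Longrightarrow> mat_trace (\<rho> g) = mat_trace (\<rho>1 g) + mat_trace (\<rho>2 g)"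
      using reducible_rep_trace[OF less.prems 3(2-4)] by metis
    then show ?thesis
      using less.IH[of k \<rho>1] less.IH[of "n - k" \<rho>2] assms(3) by auto
  qed
qed

section \<open>Induced characters\<close>

context group
begin

text \<open>Here \<open>f\<close> is a linear character of \<open>H\<close> extended by 0. Since
  \<open>u \<otimes> v\<close> is the product of \<open>u \<otimes> y\<close> and
  \<open>inv y \<otimes> v\<close>, once the second factor lies in \<open>H\<close> the first does
  exactly when \<open>u \<otimes> v\<close> does. So each \<open>y\<close> with
  \<open>inv y \<otimes> v\<close> in \<open>H\<close> contributes \<open>f (u \<otimes> v)\<close>,
  and there are \<open>card H\<close> of them.\<close>

lemma sum_linear_character_translates:
  fixes f :: "'a \<Rightarrow> complex"
  assumes fin: "finite (carrier G)" and H: "subgroup H G"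
    and f_mult: "\<And>x y. \<lbrakk>x \<in> H; y \<in> H\<rbrakk> \<Longrightarrow> f (x \<otimes> y) = f x * f y"
    and f_out: "\<And>x. x \<notin> H \<Longrightarrow> f x = 0"
    and u: "u \<in> carrier G" and v: "v \<in> carrier G"
  shows "(\<Sum>y\<in>carrier G. f (u \<otimes> y) * f (inv y \<otimes> v)) = of_nat (card H) * f (u \<otimes> v)"
proof -
  have HG: "H \<subseteq> carrier G" using H by (rule subgroup.subset)
  have prod: "u \<otimes> v = (u \<otimes> y) \<otimes> (inv y \<otimes> v)" if "y \<in> carrier G" for y
    using u v that by (simp add: m_assoc) (simp flip: m_assoc)
  have "f (u \<otimes> y) * f (inv y \<otimes> v) = (if inv y \<otimes> v \<in> H then f (u \<otimes> v) else 0)"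
    if y: "y \<in> carrier G" for y
  proof (cases "inv y \<otimes> v \<in> H")
    case in_H: True
    show ?thesis
    proof (cases "u \<otimes> y \<in> H")
      case True
      then show ?thesis using in_H f_mult prod[OF y] by simp
    next
      case False
      have "u \<otimes> v \<notin> H"
      proof
        assume "u \<otimes> v \<in> H"
        then have "(u \<otimes> v) \<otimes> inv (inv y \<otimes> v) \<in> H"
          using in_H H by (simp add: subgroup.m_closed subgroup.m_inv_closed)
        also have "(u \<otimes> v) \<otimes> inv (inv y \<otimes> v) = u \<otimes> y"
          unfolding prod[OF y] using u v y by (simp add: m_assoc)
        finally show False using False by simp
      qed
      then show ?thesis using False f_out by simp
    qed
  qed (simp add: f_out)
  then have "(\<Sum>y\<in>carrier G. f (u \<otimes> y) * f (inv y \<otimes> v))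
      = (\<Sum>y\<in>carrier G. if inv y \<otimes> v \<in> H then f (u \<otimes> v) else 0)"
    by (rule sum.cong[OF refl])
  also have "\<dots> = of_nat (card {y \<in> carrier G. inv y \<otimes> v \<in> H}) * f (u \<otimes> v)"
    using fin by (simp add: sum.If_cases Int_def)
  also have "card {y \<in> carrier G. inv y \<otimes> v \<in> H} = card H"
  proof (rule bij_betw_same_card[OF bij_betw_byWitness[where f = "\<lambda>y. inv y \<otimes> v" and f' = "\<lambda>h. v \<otimes> inv h"]])
    show "\<forall>y\<in>{y \<in> carrier G. inv y \<otimes> v \<in> H}. v \<otimes> inv (inv y \<otimes> v) = y"
      using v by (auto simp: inv_mult_group m_assoc[symmetric])
    show "\<forall>h\<in>H. inv (v \<otimes> inv h) \<otimes> v = h"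
      using v HG by (auto simp: inv_mult_group m_assoc)
    show "(\<lambda>y. inv y \<otimes> v) ` {y \<in> carrier G. inv y \<otimes> v \<in> H} \<subseteq> H" by auto
    show "(\<lambda>h. v \<otimes> inv h) ` H \<subseteq> {y \<in> carrier G. inv y \<otimes> v \<in> H}"
      using v HG by (auto simp: inv_mult_group m_assoc)
  qed
  finally show ?thesis .
qed

text \<open>Averaging \<open>f\<close> over translates gives a multiplicative family \<open>m a\<close> of operators on the functions
  on \<open>G\<close>, in which \<open>m \<one>\<close> is a projection whose image carries the induced representation.
  Adding the complementary projection makes it a representation and only shifts the trace by a
  rational constant.\<close>

lemma induced_character_rational:
  fixes f :: "'a \<Rightarrow> complex"
  assumes fin: "finite (carrier G)" and rat: "rational_group G" and H: "subgroup H G"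
    and f_one: "f \<one> = 1"
    and f_mult: "\<And>x y. \<lbrakk>x \<in> H; y \<in> H\<rbrakk> \<Longrightarrow> f (x \<otimes> y) = f x * f y"
    and f_out: "\<And>x. x \<notin> H \<Longrightarrow> f x = 0"
    and a: "a \<in> carrier G"
  shows "(\<Sum>x\<in>carrier G. f (inv x \<otimes> a \<otimes> x)) \<in> \<rat>"
proof -
  define n where "n = card (carrier G)"
  define N where "N = (of_nat (card H) :: complex)"
  have "card H \<noteq> 0"
    using H fin by (metis card_eq_0_iff finite_subset subgroup.one_closed subgroup.subset empty_iff)
  then have N: "N \<noteq> 0" "N \<in> \<rat>" by (simp_all add: N_def)
  obtain e where e: "bij_betw e {..<n} (carrier G)"
    using ex_bij_betw_nat_finite[OF fin] by (auto simp: n_def atLeast0LessThan)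
  have eG: "e i \<in> carrier G" if "i < n" for i
    using e that by (auto simp: bij_betw_def)
  have e_eq: "e i = e j \<longleftrightarrow> i = j" if "i < n" "j < n" for i j
    using e that by (auto simp: bij_betw_def inj_on_def)
  \<comment> \<open>The division by \<open>N\<close> cancels the factor \<open>card H\<close> that
    arises when two such kernels are composed.\<close>
  define m where "m b x y = f (inv x \<otimes> b \<otimes> y) / N" for b x y
  define \<delta> where "\<delta> x y = (if x = y then 1 else 0 :: complex)" for x y :: 'a
  define r where "r b x y = \<delta> x y + m b x y - m \<one> x y" for b x y
  define \<rho> where "\<rho> b = mat n n (\<lambda>(i, j). r b (e i) (e j))" for b
  have m_mult: "(\<Sum>y\<in>carrier G. m b x y * m c y z) = m (b \<otimes> c) x z"
    if "b \<in> carrier G" "c \<in> carrier G" "x \<in> carrier G" "z \<in> carrier G" for b c x z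
  proof -
    have "(\<Sum>y\<in>carrier G. m b x y * m c y z)
        = (\<Sum>y\<in>carrier G. f ((inv x \<otimes> b) \<otimes> y) * f (inv y \<otimes> (c \<otimes> z))) / N\<^sup>2"
      unfolding sum_divide_distrib
      by (intro sum.cong) (use that in \<open>simp_all add: m_def power2_eq_square m_assoc\<close>)
    also have "(\<Sum>y\<in>carrier G. f ((inv x \<otimes> b) \<otimes> y) * f (inv y \<otimes> (c \<otimes> z)))
        = N * f ((inv x \<otimes> b) \<otimes> (c \<otimes> z))"
      unfolding N_def using that
      by (intro sum_linear_character_translates fin H) (auto intro: f_mult f_out)
    also have "N * f ((inv x \<otimes> b) \<otimes> (c \<otimes> z)) / N\<^sup>2 = m (b \<otimes> c) x z"
      using N that by (simp add: m_def power2_eq_square m_assoc)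
    finally show ?thesis .
  qed
  have delta1: "(\<Sum>y\<in>carrier G. \<delta> x y * h y) = h x" if "x \<in> carrier G" for x h
  proof -
    have "(\<Sum>y\<in>carrier G. \<delta> x y * h y) = (\<Sum>y\<in>carrier G. if x = y then h y else 0)"
      by (intro sum.cong) (auto simp: \<delta>_def)
    then show ?thesis using fin that by simp
  qed
  have delta2: "(\<Sum>y\<in>carrier G. h y * \<delta> y z) = h z" if "z \<in> carrier G" for z h
  proof -
    have "(\<Sum>y\<in>carrier G. h y * \<delta> y z) = (\<Sum>y\<in>carrier G. if y = z then h y else 0)"
      by (intro sum.cong) (auto simp: \<delta>_def)
    then show ?thesis using fin that by simp
  qed
  have r_mult: "(\<Sum>y\<in>carrier G. r b x y * r c y z) = r (b \<otimes> c) x z"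
    if "b \<in> carrier G" "c \<in> carrier G" "x \<in> carrier G" "z \<in> carrier G" for b c x z
    using that
    by (simp add: r_def ring_distribs sum.distrib sum_subtractf delta1 delta2 m_mult)
  have "complex_rep G n \<rho>"
    unfolding complex_rep_iff
  proof (intro conjI ballI)
    show "\<rho> \<one> = 1\<^sub>m n"
      by (rule eq_matI) (auto simp: \<rho>_def r_def \<delta>_def e_eq)
    fix b c assume bc: "b \<in> carrier G" "c \<in> carrier G"
    show "\<rho> (b \<otimes> c) = \<rho> b * \<rho> c"
    proof (rule eq_matI)
      fix i j assume "i < dim_row (\<rho> b * \<rho> c)" "j < dim_col (\<rho> b * \<rho> c)"
      then have ij: "i < n" "j < n" by (simp_all add: \<rho>_def)
      then have "(\<rho> b * \<rho> c) $$ (i, j) = (\<Sum>l<n. r b (e i) (e l) * r c (e l) (e j))"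
        by (simp add: \<rho>_def scalar_prod_def atLeast0LessThan)
      also have "\<dots> = (\<Sum>y\<in>carrier G. r b (e i) y * r c y (e j))"
        by (rule sum.reindex_bij_betw[OF e])
      also have "\<dots> = \<rho> (b \<otimes> c) $$ (i, j)"
        using r_mult[OF bc] eG ij by (simp add: \<rho>_def)
      finally show "\<rho> (b \<otimes> c) $$ (i, j) = (\<rho> b * \<rho> c) $$ (i, j)" ..
    qed (simp_all add: \<rho>_def)
  qed (simp add: \<rho>_def)
  then have "mat_trace (\<rho> a) \<in> \<rat>"
    using rational_group_imp_trace_rational[OF rat _ a] by blast
  moreover have "mat_trace (\<rho> a) = (\<Sum>i<n. r a (e i) (e i))"
    by (simp add: mat_trace_def \<rho>_def)
  moreover have "\<dots> = (\<Sum>x\<in>carrier G. r a x x)"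
    by (rule sum.reindex_bij_betw[OF e])
  \<comment> \<open>On the diagonal \<open>m \<one> x x\<close> equals
    \<open>f \<one> / N = 1 / N\<close>, so the trace is the induced character at \<open>a\<close>
    plus the rational constant \<open>n - n / N\<close>.\<close>
  moreover have "\<dots> = (\<Sum>x\<in>carrier G. 1 + f (inv x \<otimes> a \<otimes> x) / N - 1 / N)"
    by (intro sum.cong) (simp_all add: r_def \<delta>_def m_def f_one)
  moreover have "\<dots> = of_nat n + (\<Sum>x\<in>carrier G. f (inv x \<otimes> a \<otimes> x)) / N - of_nat n / N"
    by (simp add: sum.distrib sum_subtractf sum_divide_distrib n_def)
  moreover define q where "q = of_nat n + (\<Sum>x\<in>carrier G. f (inv x \<otimes> a \<otimes> x)) / N - of_nat n / N"
  ultimately have q: "q \<in> \<rat>" by simp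
  have "(\<Sum>x\<in>carrier G. f (inv x \<otimes> a \<otimes> x)) = N * (q - of_nat n + of_nat n / N)"
    using N by (simp add: q_def)
  also have "\<dots> \<in> \<rat>" using q N(2) by (intro Rats_mult Rats_add Rats_diff Rats_divide) auto
  finally show ?thesis .
qed

end

section \<open>Conjugacy of generators in rational groups\<close>

lemma fermat_int:
  fixes a :: int
  assumes p: "prime p"
  shows "int p dvd a ^ p - a"
proof -
  define b where "b = nat (a mod int p)"
  have "p > 0" using p by (rule prime_gt_0_nat)
  then have ab: "[a = int b] (mod int p)"
    by (simp add: b_def cong_def)
  have "[b ^ p = b] (mod p)"
  proof (cases "p dvd b")
    case True
    then have "p dvd b ^ p" using \<open>p > 0\<close> by (metis dvd_power dvd_trans)
    then show ?thesis using True by (simp add: cong_def mod_eq_0_iff_dvd)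
  next
    case False
    have "[b * b ^ (p - 1) = b * 1] (mod p)"
      using fermat_theorem[OF p False] by (intro cong_mult) auto
    then show ?thesis using \<open>p > 0\<close> by (simp add: power_eq_if)
  qed
  then have "[int b ^ p = int b] (mod int p)"
    by (metis cong_int_iff of_nat_power)
  then have "[a ^ p = a] (mod int p)"
    using ab by (meson cong_pow cong_sym cong_trans)
  then show ?thesis by (simp add: cong_iff_dvd_diff)
qed

lemma primitive_root_of_unity_exists:
  assumes "0 < m"
  obtains z :: complex where "\<And>k. z ^ k = 1 \<longleftrightarrow> m dvd k"
proof
  define z where "z = cis (2 * pi / real m)"
  have bij: "bij_betw (\<lambda>k. cis (2 * pi * real k / real m)) {..<m} {z. z ^ m = 1}"
    by (rule bij_betw_roots_unity[OF assms])
  have pow: "z ^ k = cis (2 * pi * real k / real m)" for k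
    by (simp add: z_def DeMoivre mult.commute)
  have zm: "z ^ m = 1" using assms by (simp add: pow)
  show "z ^ k = 1 \<longleftrightarrow> m dvd k" for k
  proof -
    have "z ^ k = z ^ (m * (k div m) + k mod m)" by simp
    also have "\<dots> = z ^ (k mod m)" by (simp only: power_add power_mult zm power_one mult_1_left)
    finally have *: "z ^ k = z ^ (k mod m)" .
    have "z ^ (k mod m) = 1 \<longleftrightarrow> z ^ (k mod m) = z ^ 0" by simp
    also have "\<dots> \<longleftrightarrow> k mod m = 0"
      using bij assms unfolding pow bij_betw_def by (intro inj_on_eq_iff[of _ "{..<m}"]) auto
    finally show ?thesis using * by (simp add: mod_eq_0_iff_dvd)
  qed
qed

section \<open>Powers of prime exponent\<close>

context group
begin

lemma conj_nat_pow:
  assumes "x \<in> carrier G" "g \<in> carrier G"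
  shows "inv x \<otimes> g [^] (k :: nat) \<otimes> x = (inv x \<otimes> g \<otimes> x) [^] k"
proof (induction k)
  case (Suc k)
  have "inv x \<otimes> g [^] Suc k \<otimes> x = (inv x \<otimes> g [^] k \<otimes> x) \<otimes> (inv x \<otimes> g \<otimes> x)"
    using assms by (simp add: m_assoc) (simp flip: m_assoc)
  then show ?case using Suc by simp
qed (use assms in simp)

text \<open>\<open>q\<close> is an inverse of \<open>p\<close> modulo the group order, hence modulo
  the order of every element. Its use is that \<open>y\<close> is a power of \<open>y [^] p\<close>,
  so a subgroup containing \<open>y [^] p\<close> contains \<open>y\<close>.\<close>

lemma coprime_order_pow_inverse:
  assumes "coprime p (Coset.order G)"
  obtains q :: nat where "\<And>y. y \<in> carrier G \<Longrightarrow> (y [^] p) [^] q = y"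
proof -
  obtain q where q: "[p * q = 1] (mod Coset.order G)"
    using cong_solve_coprime_nat[OF assms] by auto
  have "(y [^] p) [^] q = y" if y: "y \<in> carrier G" for y
  proof -
    have "[p * q = 1] (mod group.ord G y)"
      using q ord_dvd_group_order[OF y] by (rule cong_dvd_modulus_nat)
    then have "int (group.ord G y) dvd int (p * q) - int 1"
      by (simp only: cong_iff_dvd_diff flip: cong_int_iff)
    then have "y [^] int 1 = y [^] int (p * q)"
      using int_pow_eq[OF y] by blast
    then show ?thesis using y by (simp only: int_pow_int nat_pow_pow) simp
  qed
  then show ?thesis using that by blast
qed

lemma centralizer_subgroup:
  assumes g: "g \<in> carrier G"
  shows "subgroup {x \<in> carrier G. inv x \<otimes> g \<otimes> x = g} G"
proof -
  have eq: "inv x \<otimes> g \<otimes> x = g \<longleftrightarrow> g \<otimes> x = x \<otimes> g" if "x \<in> carrier G" for x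
    using g that by (metis inv_closed inv_solve_left m_assoc m_closed)
  show ?thesis
  proof (rule subgroupI)
    fix a assume a: "a \<in> {x \<in> carrier G. inv x \<otimes> g \<otimes> x = g}"
    then have aG: "a \<in> carrier G" and ag: "inv a \<otimes> g \<otimes> a = g" by simp_all
    have "a \<otimes> (inv a \<otimes> g \<otimes> a) \<otimes> inv a = g"
      using aG g by (simp add: m_assoc) (simp flip: m_assoc)
    then show "inv a \<in> {x \<in> carrier G. inv x \<otimes> g \<otimes> x = g}" unfolding ag using aG by simp
  next
    fix a b assume "a \<in> {x \<in> carrier G. inv x \<otimes> g \<otimes> x = g}" "b \<in> {x \<in> carrier G. inv x \<otimes> g \<otimes> x = g}"
    then have ab: "a \<in> carrier G" "b \<in> carrier G" "g \<otimes> a = a \<otimes> g" "g \<otimes> b = b \<otimes> g"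
      by (auto simp: eq)
    have "g \<otimes> (a \<otimes> b) = (g \<otimes> a) \<otimes> b" using ab(1,2) g by (simp add: m_assoc)
    also have "\<dots> = a \<otimes> (g \<otimes> b)" unfolding ab(3) using ab(1,2) g by (simp add: m_assoc)
    also have "\<dots> = (a \<otimes> b) \<otimes> g" unfolding ab(4) using ab(1,2) g by (simp add: m_assoc)
    finally show "a \<otimes> b \<in> {x \<in> carrier G. inv x \<otimes> g \<otimes> x = g}"
      using ab(1,2) by (simp add: eq)
  next
    have "\<one> \<in> {x \<in> carrier G. inv x \<otimes> g \<otimes> x = g}" using g by simp
    then show "{x \<in> carrier G. inv x \<otimes> g \<otimes> x = g} \<noteq> {}" by blast
  qed blast
qed

lemma rational_group_conjugate_prime_power:
  assumes fin: "finite (carrier G)" and rat: "rational_group G"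
    and p: "prime p" "\<not> p dvd Coset.order G" and g: "g \<in> carrier G"
  shows "conjugate_in G g (g [^] p)"
proof -
  define m where "m = group.ord G g"
  have m_pos: "0 < m" using ord_ge_1[OF fin g] by (simp add: m_def)
  obtain z :: complex where z: "\<And>k. z ^ k = 1 \<longleftrightarrow> m dvd k"
    using primitive_root_of_unity_exists[OF m_pos] by blast
  have zm: "z ^ m = 1" by (simp add: z)
  define H where "H = {g [^] k |k :: nat. True}"
  have H: "subgroup H G"
    using generate_is_subgroup[of "{g}"] generate_pow_on_finite_carrier[OF fin g] g
    by (simp add: H_def)
  have HG: "H \<subseteq> carrier G" using H by (rule subgroup.subset)
  have gH: "g [^] k \<in> H" for k :: nat by (auto simp: H_def)
  \<comment> \<open>Both \<open>g\<close> and \<open>z\<close> have order \<open>m\<close>, so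
    sending \<open>g [^] k\<close> to \<open>z ^ k\<close> is well defined and injective on
    \<open>H\<close>.\<close>
  have pow_eq: "g [^] k = g [^] l \<longleftrightarrow> z ^ k = z ^ l" for k l :: nat
  proof -
    have z0: "z \<noteq> 0" using z[of m] m_pos by (auto simp: zero_power)
    have *: "g [^] k = g [^] (k + d) \<longleftrightarrow> z ^ k = z ^ (k + d)" for k d :: nat
      using g z0 z[of d] pow_eq_id[OF g, of d]
      by (simp add: nat_pow_mult[symmetric] power_add m_def)
    show ?thesis
      using *[of k "l - k"] *[of l "k - l"] by (cases "k \<le> l") auto
  qed
  \<comment> \<open>These are the linear characters of \<open>H\<close>, extended by 0. By
    \<open>pow_eq\<close> the value does not depend on which exponent \<open>SOME\<close>
    picks.\<close>
  define f where "f j y = (if y \<in> H then (z ^ (SOME k :: nat. g [^] k = y)) ^ j else 0)" for j y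
  have f_pow: "f j (g [^] k) = (z ^ k) ^ j" for j and k :: nat
  proof -
    have "g [^] (SOME l :: nat. g [^] l = g [^] k) = g [^] k"
      using someI[of "\<lambda>l :: nat. g [^] l = g [^] k" k] by simp
    then show ?thesis using gH by (simp add: f_def pow_eq)
  qed
  have f_out: "f j y = 0" if "y \<notin> H" for j y using that by (simp add: f_def)
  have f_mult: "f j (x \<otimes> y) = f j x * f j y" if xy: "x \<in> H" "y \<in> H" for j x y
  proof -
    obtain k l :: nat where "x = g [^] k" "y = g [^] l" using xy by (auto simp: H_def)
    then show ?thesis using g f_pow[of j "k + l"]
      by (simp add: nat_pow_mult f_pow power_add power_mult_distrib)
  qed
  have f_one: "f j \<one> = 1" for j using f_pow[of j 0] by simp
  have "coprime p (Coset.order G)" using p by (rule prime_imp_coprime_nat)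
  then obtain q :: nat where q: "\<And>y. y \<in> carrier G \<Longrightarrow> (y [^] p) [^] q = y"
    using coprime_order_pow_inverse by blast
  \<comment> \<open>This holds on all of \<open>G\<close>, not only on \<open>H\<close>: if
    \<open>y\<close> is outside \<open>H\<close>, so is \<open>y [^] p\<close>, because
    \<open>y\<close> is the \<open>q\<close>-th power of it.\<close>
  have f_frob: "f j (y [^] p) = f j y ^ p" if y: "y \<in> carrier G" for j y
  proof (cases "y \<in> H")
    case True
    then obtain k :: nat where "y = g [^] k" by (auto simp: H_def)
    then show ?thesis using g by (simp add: nat_pow_pow f_pow flip: power_mult) (simp add: ac_simps)
  next
    case False
    have "y [^] p \<notin> H"
    proof
      assume "y [^] p \<in> H"
      then obtain k :: nat where "y [^] p = g [^] k" by (auto simp: H_def)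
      then have "y = g [^] (k * q)" using q[OF y] g by (simp add: nat_pow_pow)
      then show False using False gH by simp
    qed
    then show ?thesis using False prime_gt_0_nat[OF p(1)] by (simp add: f_out zero_power)
  qed
  have f_adjoin: "f j y \<in> int_adjoin z" for j y
    using int_adjoin_of_int[of 0 z] by (auto simp: f_def intro!: int_adjoin_power)
  \<comment> \<open>\<open>S j\<close> is \<open>card H\<close> times the character induced from
    \<open>f j\<close>, and \<open>c g\<close> is the order of the centralizer of
    \<open>g\<close>.\<close>
  define S where "S j a = (\<Sum>x\<in>carrier G. f j (inv x \<otimes> a \<otimes> x))" for j a
  define c where "c a = card {x \<in> carrier G. inv x \<otimes> a \<otimes> x = g}" for a
  have S_int: "S j a \<in> \<int>" if "a \<in> carrier G" for j a
  proof -
    have "S j a \<in> \<rat>" unfolding S_def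
      by (rule induced_character_rational[OF fin rat H f_one f_mult f_out that])
    moreover have "S j a \<in> int_adjoin z"
      unfolding S_def by (intro int_adjoin_sum f_adjoin)
    ultimately show ?thesis
      by (intro int_adjoin_root_of_unity_Rats_imp_Ints[OF zm m_pos])
  qed
  \<comment> \<open>By \<open>f_frob\<close>, \<open>S j (g [^] p)\<close> is the sum of the
    \<open>p\<close>-th powers of the terms of \<open>S j g\<close>, hence congruent to
    \<open>S j g ^ p\<close>; as \<open>S j g\<close> is an integer, Fermat's theorem reduces this
    to \<open>S j g\<close>.\<close>
  have S_frob: "\<exists>b\<in>int_adjoin z. S j (g [^] p) - S j g = of_nat p * b" for j
  proof -
    have "S j (g [^] p) = (\<Sum>x\<in>carrier G. f j (inv x \<otimes> g \<otimes> x) ^ p)"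
      unfolding S_def by (intro sum.cong) (use g in \<open>simp_all add: conj_nat_pow f_frob\<close>)
    then obtain b where b: "b \<in> int_adjoin z" "S j g ^ p = S j (g [^] p) + of_nat p * b"
      using prime_power_sum_int_adjoin[OF p(1), of "carrier G" "\<lambda>x. f j (inv x \<otimes> g \<otimes> x)" z] f_adjoin
      by (auto simp: S_def)
    obtain s where s: "S j g = of_int s" using S_int[OF g] by (auto elim: Ints_cases)
    obtain t where t: "s ^ p - s = int p * t" using fermat_int[OF p(1), of s] by auto
    have "S j g ^ p - S j g = of_int (s ^ p - s)" by (simp add: s)
    then have "S j g ^ p - S j g = of_nat p * of_int t" by (simp add: t)
    then have "S j (g [^] p) - S j g = of_nat p * (of_int t - b)"
      using b(2) by (simp add: algebra_simps)
    then show ?thesis by (rule bexI) (intro int_adjoin_diff int_adjoin_of_int b(1))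
  qed
  then obtain b where b: "\<And>j. b j \<in> int_adjoin z" "\<And>j. S j (g [^] p) - S j g = of_nat p * b j"
    by metis
  \<comment> \<open>\<open>w\<close> is the inverse of \<open>z\<close>, written as a power so that
    it visibly lies in \<int>[z].\<close>
  define w where "w = z ^ (m - 1)"
  have wz: "w * z = 1" using power_minus_mult[OF m_pos, of z] by (simp only: w_def zm)
  \<comment> \<open>Orthogonality: for \<open>y = g [^] k\<close> the sum is geometric in the root
    of unity \<open>z ^ k * w\<close>, which is 1 exactly when \<open>y = g\<close>. Off
    \<open>H\<close> all terms vanish.\<close>
  have fourier: "(\<Sum>j<m. f j y * w ^ j) = (if y = g then of_nat m else 0)" for y
  proof (cases "y \<in> H")
    case True
    then obtain k :: nat where k: "y = g [^] k" by (auto simp: H_def)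
    have "(\<Sum>j<m. f j y * w ^ j) = (\<Sum>j<m. (z ^ k * w) ^ j)"
      by (simp only: k f_pow power_mult_distrib)
    also have "\<dots> = (if z ^ k * w = 1 then of_nat m else 0)"
    proof (rule sum_root_of_unity_powers)
      have "(z ^ k * w) ^ m = (z ^ m) ^ k * (z ^ m) ^ (m - 1)"
        unfolding w_def power_mult_distrib by (simp only: mult.commute flip: power_mult)
      then show "(z ^ k * w) ^ m = 1" by (simp only: zm power_one mult_1_left)
    qed
    also have "z ^ k * w = 1 \<longleftrightarrow> z ^ k * w = z * w"
      using wz by (simp add: mult.commute)
    also have "\<dots> \<longleftrightarrow> z ^ k = z ^ 1"
      using wz by auto
    also have "z ^ k = z ^ 1 \<longleftrightarrow> y = g"
      using pow_eq[of k 1] g by (simp add: k)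
    finally show ?thesis .
  next
    case False
    then show ?thesis using gH[of 1] g by (auto simp: f_out)
  qed
  have count: "(\<Sum>j<m. S j a * w ^ j) = of_nat (m * c a)" for a
  proof -
    have "(\<Sum>j<m. S j a * w ^ j)
        = (\<Sum>x\<in>carrier G. \<Sum>j<m. f j (inv x \<otimes> a \<otimes> x) * w ^ j)"
      unfolding S_def sum_distrib_right by (rule sum.swap)
    also have "\<dots> = of_nat (m * c a)"
      unfolding fourier using fin by (simp add: sum.If_cases Int_def c_def mult.commute)
    finally show ?thesis .
  qed
  \<comment> \<open>Weighting the congruences for the separate \<open>j\<close> by
    \<open>w ^ j\<close> and adding them compares the two counts; \<open>\<beta>\<close> is the
    resulting quotient by \<open>p\<close>.\<close>
  define \<beta> where "\<beta> = (\<Sum>j<m. b j * w ^ j)"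
  have "of_nat (m * c (g [^] p)) - of_nat (m * c g) = (of_nat p * \<beta> :: complex)"
    unfolding count[symmetric] \<beta>_def sum_distrib_left sum_subtractf[symmetric]
    using b(2) by (intro sum.cong) (simp_all add: left_diff_distrib[symmetric])
  then have *: "of_int (int (m * c (g [^] p)) - int (m * c g)) = (of_nat p * \<beta> :: complex)"
    by simp
  have "\<beta> \<in> int_adjoin z"
    unfolding \<beta>_def w_def by (intro int_adjoin_sum int_adjoin_mult int_adjoin_power b int_adjoin_generator)
  moreover have "\<beta> \<in> \<rat>"
  proof -
    have "\<beta> = of_int (int (m * c (g [^] p)) - int (m * c g)) / of_nat p"
      unfolding * using prime_gt_0_nat[OF p(1)] by simp
    then show ?thesis by (metis Rats_divide Rats_of_int Rats_of_nat)
  qed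
  ultimately have "\<beta> \<in> \<int>"
    by (intro int_adjoin_root_of_unity_Rats_imp_Ints[OF zm m_pos])
  then obtain t where "\<beta> = of_int t" by (auto elim: Ints_cases)
  then have "(of_int (int (m * c (g [^] p)) - int (m * c g)) :: complex) = of_int (int p * t)"
    unfolding * by simp
  then have dvd: "int (m * c (g [^] p)) - int (m * c g) = int p * t"
    unfolding of_int_eq_iff .
  \<comment> \<open>The orders of the centralizer and of \<open>g\<close> both divide the group
    order, so \<open>p\<close> divides neither, and the congruence excludes
    \<open>c (g [^] p) = 0\<close>.\<close>
  have "c g dvd Coset.order G"
    unfolding c_def lagrange[OF centralizer_subgroup[OF g], symmetric] by (rule dvd_triv_right)
  moreover have "m dvd Coset.order G" unfolding m_def by (rule ord_dvd_group_order[OF g])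
  ultimately have "\<not> p dvd m * c g"
    unfolding prime_dvd_mult_iff[OF p(1)] using p(2) by (blast dest: dvd_trans)
  then have "c (g [^] p) \<noteq> 0"
  proof (rule contrapos_nn)
    assume "c (g [^] p) = 0"
    then have "int (m * c g) = int p * (- t)" using dvd by simp
    then have "int p dvd int (m * c g)" by (rule dvdI)
    then show "p dvd m * c g" by (simp only: int_dvd_int_iff)
  qed
  then have "{x \<in> carrier G. inv x \<otimes> g [^] p \<otimes> x = g} \<noteq> {}"
    unfolding c_def by (metis card.empty)
  then obtain x where x: "x \<in> carrier G" and gx: "inv x \<otimes> g [^] p \<otimes> x = g"
    by blast
  have "x \<otimes> (inv x \<otimes> g [^] p \<otimes> x) \<otimes> inv x = g [^] p"
    using x g by (simp add: m_assoc) (simp flip: m_assoc)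
  then have "g [^] p = x \<otimes> g \<otimes> inv x" unfolding gx ..
  then show ?thesis unfolding conjugate_in_def by (rule bexI[OF _ x])
qed

end

text \<open>With \<open>t\<close> the product of the primes dividing \<open>n\<close> but not
  \<open>k\<close>, each prime divisor of \<open>n\<close> divides exactly one of \<open>k\<close>
  and \<open>m * t\<close>, hence not their sum \<open>l\<close>.\<close>

lemma coprime_lift_modulus:
  fixes k m n :: nat
  assumes "coprime k m" "m dvd n" "0 < n"
  obtains l where "[l = k] (mod m)" "coprime l n"
proof
  define t where "t = \<Prod>{q \<in> prime_factors n. \<not> q dvd k}"
  show "[k + m * t = k] (mod m)" by (simp add: cong_def)
  show "coprime (k + m * t) n"
  proof (rule ccontr)
    assume "\<not> coprime (k + m * t) n"
    then have "gcd (k + m * t) n \<noteq> 1" by (simp only: coprime_iff_gcd_eq_1 not_False_eq_True)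
    then obtain q where "prime q" "q dvd gcd (k + m * t) n" using prime_factor_nat by blast
    then have q: "prime q" "q dvd k + m * t" "q dvd n" by simp_all
    have t: "q dvd t \<longleftrightarrow> \<not> q dvd k"
    proof
      assume "q dvd t"
      then obtain r where "prime r" "q dvd r" "\<not> r dvd k"
        unfolding t_def using q(1) by (auto simp: prime_dvd_prod_iff)
      then show "\<not> q dvd k" using q(1) primes_dvd_imp_eq by blast
    next
      assume "\<not> q dvd k"
      then have "q \<in> {q \<in> prime_factors n. \<not> q dvd k}"
        using q assms(3) by (simp add: prime_factors_dvd)
      then show "q dvd t" unfolding t_def by (intro dvd_prodI) auto
    qed
    show False
    proof (cases "q dvd k")
      case True
      then have "q dvd m * t" using q(2) by (simp add: dvd_add_right_iff)
      then have "q dvd m" using t True q(1) by (simp add: prime_dvd_mult_iff)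
      then show False using True assms(1) q(1) by (meson coprime_common_divisor not_prime_unit)
    next
      case False
      then have "q dvd m * t" using t by simp
      then show False using False q(2) by (simp add: dvd_add_left_iff)
    qed
  qed
qed

section \<open>Powers of arbitrary coprime exponent\<close>

context group
begin

lemma conjugate_in_refl: "g \<in> carrier G \<Longrightarrow> conjugate_in G g g"
  unfolding conjugate_in_def by (intro bexI[of _ \<one>]) simp_all

lemma conjugate_in_trans:
  assumes "conjugate_in G g h" "conjugate_in G h k" "g \<in> carrier G"
  shows "conjugate_in G g k"
proof -
  obtain x y where "x \<in> carrier G" "h = x \<otimes> g \<otimes> inv x" "y \<in> carrier G" "k = y \<otimes> h \<otimes> inv y"
    using assms by (auto simp: conjugate_in_def)
  then have "k = (y \<otimes> x) \<otimes> g \<otimes> inv (y \<otimes> x)" "y \<otimes> x \<in> carrier G"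
    using assms(3) by (simp_all add: inv_mult_group m_assoc)
  then show ?thesis unfolding conjugate_in_def by blast
qed

text \<open>Prime factors are split off \<open>k\<close> one at a time. The induction keeps
  \<open>g\<close> arbitrary because the remaining factor \<open>l\<close> acts on
  \<open>g [^] p\<close>.\<close>

lemma rational_group_conjugate_coprime_power:
  assumes fin: "finite (carrier G)" and rat: "rational_group G"
  shows "\<lbrakk>coprime k (Coset.order G); g \<in> carrier G\<rbrakk> \<Longrightarrow> conjugate_in G g (g [^] k)"
proof (induction k arbitrary: g rule: less_induct)
  case (less k)
  show ?case
  proof (cases "\<exists>p. prime p \<and> p dvd k \<and> k \<noteq> 0")
    case True
    then obtain p l where p: "prime p" and k: "k = p * l" "k \<noteq> 0" by auto
    then have "l < k" using prime_gt_1_nat[OF p] by simp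
    have cop: "coprime p (Coset.order G)" "coprime l (Coset.order G)"
      using less.prems(1) by (simp_all add: k(1))
    have "\<not> p dvd Coset.order G"
      using cop(1) p by (meson coprime_common_divisor dvd_refl not_prime_unit)
    then have "conjugate_in G g (g [^] p)"
      by (rule rational_group_conjugate_prime_power[OF fin rat p _ less.prems(2)])
    moreover have "conjugate_in G (g [^] p) ((g [^] p) [^] l)"
      using less.IH[OF \<open>l < k\<close> cop(2)] less.prems(2) by simp
    ultimately show ?thesis
      using conjugate_in_trans less.prems(2) by (simp add: k(1) nat_pow_pow)
  next
    case False
    have "g [^] k = g"
    \<comment> \<open>The exponent 0 is coprime to the group order only when the group is
      trivial.\<close>
    proof (cases "k = 0")
      case True
      then have "Coset.order G = 1" using less.prems(1) by simp
      then have "g [^] (1 :: nat) = \<one>" using pow_order_eq_1[OF less.prems(2)] by simp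
      then show ?thesis using True less.prems(2) by simp
    next
      case k: False
      then have "k = 1" using False prime_factor_nat by blast
      then show ?thesis using less.prems(2) by simp
    qed
    then show ?thesis using conjugate_in_refl[OF less.prems(2)] by simp
  qed
qed

text \<open>\<open>g [^] k\<close> depends only on \<open>k\<close> modulo the order of
  \<open>g\<close>, and in that residue class \<open>k\<close> can be replaced by an exponent
  coprime to the group order.\<close>

lemma rational_group_conjugate_generator:
  assumes fin: "finite (carrier G)" and rat: "rational_group G"
    and g: "g \<in> carrier G" and k: "coprime k (group.ord G g)"
  shows "conjugate_in G g (g [^] k)"
proof -
  obtain l where l: "[l = k] (mod group.ord G g)" "coprime l (Coset.order G)"
    using coprime_lift_modulus[OF k ord_dvd_group_order[OF g]] fin order_gt_0_iff_finite by blast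
  have "int (group.ord G g) dvd int l - int k"
    using l(1) by (simp only: cong_iff_dvd_diff flip: cong_int_iff)
  then have "g [^] int k = g [^] int l"
    using int_pow_eq[OF g] by blast
  then show ?thesis
    using rational_group_conjugate_coprime_power[OF fin rat l(2) g] by (simp only: int_pow_int)
qed

section \<open>Rationality from conjugate generators\<close>

lemma complex_rep_nat_pow:
  assumes "complex_rep G n \<rho>" "g \<in> carrier G"
  shows "\<rho> (g [^] (k :: nat)) = \<rho> g ^\<^sub>m k"
  using assms by (induction k) (auto simp: complex_rep_iff)

lemma mat_trace_conjugate_in:
  assumes rep: "complex_rep G n \<rho>" and "g \<in> carrier G" "conjugate_in G g h"
  shows "mat_trace (\<rho> h) = mat_trace (\<rho> g)"
proof -
  obtain x where x: "x \<in> carrier G" "h = x \<otimes> g \<otimes> inv x"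
    using assms by (auto simp: conjugate_in_def)
  have "\<rho> h = \<rho> x * \<rho> g * \<rho> (inv x)"
    using rep x assms(2) by (simp add: complex_rep_iff)
  moreover have "\<rho> (inv x) * \<rho> x = 1\<^sub>m n"
    using rep x(1) unfolding complex_rep_iff by (metis inv_closed l_inv)
  moreover have "\<rho> x \<in> carrier_mat n n" "\<rho> g \<in> carrier_mat n n" "\<rho> (inv x) \<in> carrier_mat n n"
    using rep x(1) assms(2) by (simp_all add: complex_rep_iff)
  ultimately show ?thesis
    by (simp only: mat_trace_conjugation)
qed

lemma rational_groupI:
  assumes fin: "finite (carrier G)"
    and conj: "\<And>g k. \<lbrakk>g \<in> carrier G; coprime k (group.ord G g)\<rbrakk> \<Longrightarrow> conjugate_in G g (g [^] (k :: nat))"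
  shows "rational_group G"
  unfolding rational_group_def
proof (intro allI impI ballI)
  fix \<chi> g assume "irreducible_character G \<chi>" and g: "g \<in> carrier G"
  then obtain n \<rho> where rep: "complex_rep G n \<rho>" and \<chi>: "\<chi> g = mat_trace (\<rho> g)"
    by (auto simp: irreducible_character_def irreducible_rep_def)
  define m where "m = group.ord G g"
  define K where "K = {k. k < m \<and> coprime k m}"
  have m_pos: "0 < m" using ord_ge_1[OF fin g] by (simp add: m_def)
  have \<rho>: "\<rho> g \<in> carrier_mat n n" using rep g by (simp add: complex_rep_iff)
  have "\<rho> g ^\<^sub>m m = \<rho> \<one>"
    using complex_rep_nat_pow[OF rep g, of m] g by (simp add: m_def)
  also have "\<dots> = 1\<^sub>m n" using rep by (simp add: complex_rep_iff)
  finally have "(\<Sum>k\<in>K. mat_trace (\<rho> g ^\<^sub>m k)) \<in> \<rat>"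
    unfolding K_def by (rule sum_mat_trace_coprime_powers_rational[OF \<rho> _ m_pos])
  also have "(\<Sum>k\<in>K. mat_trace (\<rho> g ^\<^sub>m k)) = (\<Sum>k\<in>K. \<chi> g)"
  proof (rule sum.cong[OF refl])
    fix k assume "k \<in> K"
    then have "conjugate_in G g (g [^] k)" using conj[OF g] by (simp add: K_def m_def)
    then have "mat_trace (\<rho> (g [^] k)) = mat_trace (\<rho> g)"
      by (rule mat_trace_conjugate_in[OF rep g])
    then show "mat_trace (\<rho> g ^\<^sub>m k) = \<chi> g"
      by (simp only: complex_rep_nat_pow[OF rep g] \<chi>)
  qed
  finally have "of_nat (card K) * \<chi> g \<in> \<rat>" by simp
  moreover have "card K \<noteq> 0"
  proof -
    \<comment> \<open>For \<open>m = 1\<close> the set \<open>K\<close> is \<open>{0}\<close>, hence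
      \<open>1 mod m\<close> instead of 1.\<close>
    have "1 mod m \<in> K" using m_pos by (cases "m = 1") (auto simp: K_def)
    then show ?thesis by (auto simp: K_def card_eq_0_iff)
  qed
  ultimately have "of_nat (card K) * \<chi> g / of_nat (card K) \<in> \<rat>"
    by (intro Rats_divide) auto
  then show "\<chi> g \<in> \<rat>" using \<open>card K \<noteq> 0\<close> by simp
qed

section \<open>Geometries separating conjugacy classes\<close>

lemma Aut_geometry_hom:
  assumes "\<theta> \<in> hom G (Aut_geometry X inc t)"
  shows "a \<in> carrier G \<Longrightarrow> \<theta> a \<in> Bij X"
    and "\<lbrakk>a \<in> carrier G; b \<in> carrier G\<rbrakk> \<Longrightarrow> \<theta> (a \<otimes> b) = compose X (\<theta> a) (\<theta> b)"
proof -
  show Bij: "\<theta> a \<in> Bij X" if "a \<in> carrier G" for a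
    using assms that by (auto simp: hom_def Aut_geometry_def)
  show "\<theta> (a \<otimes> b) = compose X (\<theta> a) (\<theta> b)" if "a \<in> carrier G" "b \<in> carrier G"
    using assms that Bij by (simp add: hom_def Aut_geometry_def BijGroup_def)
qed

lemma fixed_flags_subset_power:
  assumes \<theta>: "\<theta> \<in> hom G (Aut_geometry X inc t)" and g: "g \<in> carrier G"
  shows "fixed_flags X inc t J (\<theta> g) \<subseteq> fixed_flags X inc t J (\<theta> (g [^] (k :: nat)))"
proof
  fix F assume F: "F \<in> fixed_flags X inc t J (\<theta> g)"
  then have FX: "F \<subseteq> X" and fix_g: "\<theta> g ` F = F" by (auto simp: fixed_flags_def flag_def)
  have image: "\<theta> (a \<otimes> b) ` F' = \<theta> a ` \<theta> b ` F'"
    if "a \<in> carrier G" "b \<in> carrier G" "F' \<subseteq> X" for a b F'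
    using Aut_geometry_hom(2)[OF \<theta> that(1,2)] that(3) by (auto simp: compose_def image_image image_def)
  \<comment> \<open>Membership in \<open>hom\<close> states only multiplicativity; an idempotent
    bijection of \<open>X\<close> is the identity on \<open>X\<close>.\<close>
  have one: "\<theta> \<one> x = x" if x: "x \<in> X" for x
  proof -
    have bij: "bij_betw (\<theta> \<one>) X X" using Aut_geometry_hom(1)[OF \<theta>, of \<one>] by (simp add: Bij_def)
    then have "\<theta> \<one> x \<in> X" using x by (rule bij_betw_apply)
    moreover have "\<theta> (\<one> \<otimes> \<one>) x = \<theta> \<one> (\<theta> \<one> x)"
      by (simp only: Aut_geometry_hom(2)[OF \<theta> one_closed one_closed] compose_eq[OF x])
    then have "\<theta> \<one> (\<theta> \<one> x) = \<theta> \<one> x" by simp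
    ultimately show ?thesis using x inj_onD[OF bij_betw_imp_inj_on[OF bij]] by blast
  qed
  have "\<theta> (g [^] k) ` F = F"
  proof (induction k)
    case 0
    then show ?case using one FX by (auto simp: subset_iff image_def)
  next
    case (Suc k)
    then show ?case using image[of "g [^] k" g F] g FX fix_g by simp
  qed
  then show "F \<in> fixed_flags X inc t J (\<theta> (g [^] k))"
    using F by (simp add: fixed_flags_def)
qed

lemma flag_counts_imp_rational_group:
  assumes fin: "finite (carrier G)" and \<theta>: "\<theta> \<in> hom G (Aut_geometry X inc t)"
    and sep: "flag_counts_separate_classes G I X inc t \<theta>"
  shows "rational_group G"
proof (rule rational_groupI[OF fin])
  fix g and k :: nat assume g: "g \<in> carrier G" and k: "coprime k (group.ord G g)"
  \<comment> \<open>\<open>l\<close> inverts \<open>k\<close> modulo the order of \<open>g\<close>,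
    so \<open>g\<close> is in turn a power of \<open>g [^] k\<close> and the inclusion of fixed
    flags holds both ways.\<close>
  obtain l where l: "[k * l = 1] (mod group.ord G g)"
    using cong_solve_coprime_nat[OF k] by auto
  then have "int (group.ord G g) dvd int (k * l) - int 1"
    by (simp only: cong_iff_dvd_diff flip: cong_int_iff)
  then have "g [^] int 1 = g [^] int (k * l)"
    using int_pow_eq[OF g] by blast
  then have g_eq: "g = (g [^] k) [^] l" using g by (simp only: int_pow_int nat_pow_pow) simp
  have "fixed_flags X inc t J (\<theta> g) = fixed_flags X inc t J (\<theta> (g [^] k))" for J
  proof
    show "fixed_flags X inc t J (\<theta> g) \<subseteq> fixed_flags X inc t J (\<theta> (g [^] k))"
      by (rule fixed_flags_subset_power[OF \<theta> g])
    show "fixed_flags X inc t J (\<theta> (g [^] k)) \<subseteq> fixed_flags X inc t J (\<theta> g)"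
      using fixed_flags_subset_power[OF \<theta>, of "g [^] k" J l] g g_eq by simp
  qed
  then show "conjugate_in G g (g [^] k)"
    using sep g by (simp add: flag_counts_separate_classes_def)
qed


text \<open>A finite \<open>G\<close>-set with invariant types becomes a geometry when distinct elements are never
  incident: its nonempty flags are then the singletons.\<close>

lemma geometry_of_typed_action:
  fixes s :: "'y \<Rightarrow> nat" and act :: "'a \<Rightarrow> 'y \<Rightarrow> 'y"
  assumes Y: "finite Y" "Y \<noteq> {}"
    and closed: "\<And>a y. \<lbrakk>a \<in> carrier G; y \<in> Y\<rbrakk> \<Longrightarrow> act a y \<in> Y"
    and one: "\<And>y. y \<in> Y \<Longrightarrow> act \<one> y = y"
    and mult: "\<And>a b y. \<lbrakk>a \<in> carrier G; b \<in> carrier G; y \<in> Y\<rbrakk> \<Longrightarrow> act (a \<otimes> b) y = act a (act b y)"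
    and type: "\<And>a y. \<lbrakk>a \<in> carrier G; y \<in> Y\<rbrakk> \<Longrightarrow> s (act a y) = s y"
  obtains I X :: "nat set" and inc t \<theta>
  where "geometry I X inc t" "finite X" "\<theta> \<in> hom G (Aut_geometry X inc t)"
    and "\<forall>a\<in>carrier G. \<forall>b\<in>carrier G.
        (\<forall>J\<subseteq>I. card (fixed_flags X inc t J (\<theta> a)) = card (fixed_flags X inc t J (\<theta> b))) \<longrightarrow>
        (\<forall>y\<in>Y. act a y = y \<longrightarrow> (\<exists>y'\<in>Y. s y' = s y \<and> act b y' = y'))"
proof -
  \<comment> \<open>The points are coded by natural numbers, decoded by \<open>d\<close>, so that
    the geometry lives on \<open>nat\<close> whatever the type of \<open>Y\<close>.\<close>
  obtain e :: "'y \<Rightarrow> nat" where e: "inj_on e Y"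
    using finite_imp_inj_to_nat_seg[OF Y(1)] by blast
  define X where "X = e ` Y"
  define d where "d = the_inv_into Y e"
  have de [simp]: "d (e y) = y" if "y \<in> Y" for y
    using the_inv_into_f_f[OF e that] by (simp add: d_def)
  have eX: "e y \<in> X" if "y \<in> Y" for y using that by (simp add: X_def)
  have dY: "d x \<in> Y" and ed: "e (d x) = x" if "x \<in> X" for x
    using that by (auto simp: X_def)
  define t where "t x = s (d x)" for x
  define \<theta> where "\<theta> a = (\<lambda>x\<in>X. e (act a (d x)))" for a
  have \<theta>_X: "\<theta> a x \<in> X" if "a \<in> carrier G" "x \<in> X" for a x
    using that closed dY eX by (simp add: \<theta>_def)
  have \<theta>_mult: "\<theta> (a \<otimes> b) = compose X (\<theta> a) (\<theta> b)" if "a \<in> carrier G" "b \<in> carrier G" for a b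
    using that closed dY eX mult by (auto simp: \<theta>_def compose_def fun_eq_iff)
  have \<theta>_one: "\<theta> \<one> x = x" if "x \<in> X" for x
    using that one dY ed by (simp add: \<theta>_def)
  have \<theta>_t: "t (\<theta> a x) = t x" if "a \<in> carrier G" "x \<in> X" for a x
    using that closed dY type by (simp add: \<theta>_def t_def)
  have \<theta>_inv: "\<theta> (inv a) (\<theta> a x) = x \<and> \<theta> a (\<theta> (inv a) x) = x"
    if a: "a \<in> carrier G" and x: "x \<in> X" for a x
  proof -
    have "\<theta> (inv a) (\<theta> a x) = \<theta> (inv a \<otimes> a) x"
      by (simp only: \<theta>_mult[OF inv_closed[OF a] a] compose_eq[OF x])
    moreover have "\<theta> a (\<theta> (inv a) x) = \<theta> (a \<otimes> inv a) x"
      by (simp only: \<theta>_mult[OF a inv_closed[OF a]] compose_eq[OF x])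
    ultimately show ?thesis using \<theta>_one[OF x] a by simp
  qed
  have \<theta>_Bij: "\<theta> a \<in> Bij X" if a: "a \<in> carrier G" for a
  proof -
    have "bij_betw (\<theta> a) X X"
      by (rule bij_betw_byWitness[where f' = "\<theta> (inv a)"]) (use a \<theta>_inv \<theta>_X in auto)
    then show ?thesis by (simp add: Bij_def \<theta>_def)
  qed
  have preserves: "preserves_geometry X (Id_on X) t \<alpha>" if "\<And>x. x \<in> X \<Longrightarrow> \<alpha> x \<in> X" "\<And>x. x \<in> X \<Longrightarrow> t (\<alpha> x) = t x" for \<alpha>
    using that by (auto simp: preserves_geometry_def Id_on_iff)
  have "preserves_geometry X (Id_on X) t (inv_into X (\<theta> a))" if a: "a \<in> carrier G" for a
  proof (rule preserves)
    fix x assume x: "x \<in> X"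
    show inv_X: "inv_into X (\<theta> a) x \<in> X" by (rule Bij_inv_into_mem[OF \<theta>_Bij[OF a] x])
    have "\<theta> a (inv_into X (\<theta> a) x) = x"
      using \<theta>_Bij[OF a] x by (simp add: Bij_def bij_betw_def f_inv_into_f)
    then show "t (inv_into X (\<theta> a) x) = t x" using \<theta>_t[OF a inv_X] by simp
  qed
  then have hom: "\<theta> \<in> hom G (Aut_geometry X (Id_on X) t)"
    using \<theta>_Bij \<theta>_X \<theta>_t \<theta>_mult preserves by (simp add: hom_def Aut_geometry_def BijGroup_def Pi_iff)
  have finX: "finite X" using Y by (simp add: X_def)
  have geo: "geometry (s ` Y) X (Id_on X) t"
    using Y dY by unfold_locales (auto simp: X_def t_def refl_on_def sym_Id_on Id_on_iff)
  have fixed: "\<exists>y'\<in>Y. s y' = s y \<and> act b y' = y'"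
    if a: "a \<in> carrier G" and b: "b \<in> carrier G"
      and counts: "\<forall>J\<subseteq>s ` Y. card (fixed_flags X (Id_on X) t J (\<theta> a)) = card (fixed_flags X (Id_on X) t J (\<theta> b))"
      and y: "y \<in> Y" "act a y = y" for a b y
  proof -
    \<comment> \<open>Finiteness matters, since an infinite set would have \<open>card\<close> 0
      despite the member \<open>{e y}\<close>.\<close>
    have "fixed_flags X (Id_on X) t {s y} (\<theta> a) \<subseteq> Pow X"
      by (auto simp: fixed_flags_def flag_def)
    then have "finite (fixed_flags X (Id_on X) t {s y} (\<theta> a))"
      using finX finite_subset by blast
    moreover have "{e y} \<in> fixed_flags X (Id_on X) t {s y} (\<theta> a)"
      using y eX by (simp add: fixed_flags_def flag_def t_def \<theta>_def Id_on_iff)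
    ultimately have "card (fixed_flags X (Id_on X) t {s y} (\<theta> a)) \<noteq> 0"
      by (metis card_eq_0_iff empty_iff)
    then have "card (fixed_flags X (Id_on X) t {s y} (\<theta> b)) \<noteq> 0"
      using counts y(1) by simp
    then obtain F where F: "F \<in> fixed_flags X (Id_on X) t {s y} (\<theta> b)"
      by (metis card.empty ex_in_conv)
    then have "s y \<in> t ` F" and FX: "F \<subseteq> X" by (simp_all add: fixed_flags_def flag_def)
    then obtain x where x: "x \<in> F" "x \<in> X" "t x = s y" by auto
    \<comment> \<open>Two members of a flag are equal under the identity incidence, so
      \<open>x\<close> is itself fixed.\<close>
    have "\<theta> b x \<in> F" using F x by (auto simp: fixed_flags_def)
    then have "(\<theta> b x, x) \<in> Id_on X" using F x by (simp add: fixed_flags_def flag_def)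
    then have "e (act b (d x)) = x" using x(2) by (simp add: \<theta>_def Id_on_iff)
    then have "act b (d x) = d x" using closed[OF b dY[OF x(2)]] by (metis de)
    then show ?thesis using x(3) dY[OF x(2)] by (auto simp: t_def)
  qed
  show ?thesis by (rule that[OF geo finX hom]) (use fixed in blast)
qed

section \<open>The geometry of cosets of cyclic subgroups\<close>

lemma rational_group_imp_separating_geometry:
  assumes fin: "finite (carrier G)" and rat: "rational_group G"
  shows "\<exists>(I :: nat set) (X :: nat set) inc t \<theta>.
    geometry I X inc t \<and> finite X \<and> \<theta> \<in> hom G (Aut_geometry X inc t) \<and>
    flag_counts_separate_classes G I X inc t \<theta>"
proof -
  define C where "C g = generate G {g}" for g
  have C: "C g = {g [^] k |k :: nat. True}" if "g \<in> carrier G" for g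
    using generate_pow_on_finite_carrier[OF fin that] by (simp add: C_def)
  have CG: "C g \<subseteq> carrier G" if "g \<in> carrier G" for g
    using that by (auto simp: C)
  obtain \<iota> :: "'a \<Rightarrow> nat" where \<iota>: "inj_on \<iota> (carrier G)"
    using finite_imp_inj_to_nat_seg[OF fin] by blast
  \<comment> \<open>The first component, a generator, is the type of the coset. A cyclic subgroup
    therefore contributes one family of cosets for each of its generators, and a point with the type
    of \<open>g\<close> is always a coset of \<open>C g\<close>.\<close>
  define Y where "Y = (SIGMA g:carrier G. (\<lambda>x. x <# C g) ` carrier G)"
  define s where "s = \<iota> \<circ> (fst :: 'a \<times> 'a set \<Rightarrow> 'a)"
  define act where "act a y = (fst y, a <# snd y)" for a and y :: "'a \<times> 'a set"
  have Y1: "finite Y" using fin by (auto simp: Y_def)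
  have Y2: "Y \<noteq> {}" by (auto simp: Y_def)
  have closed: "act a y \<in> Y" if "a \<in> carrier G" "y \<in> Y" for a y
    using that by (auto simp: Y_def act_def lcos_m_assoc CG)
  have one: "act \<one> y = y" if "y \<in> Y" for y
    using that by (auto simp: Y_def act_def lcos_m_assoc CG)
  have mult: "act (a \<otimes> b) y = act a (act b y)" if "a \<in> carrier G" "b \<in> carrier G" "y \<in> Y" for a b y
    using that by (auto simp: Y_def act_def lcos_m_assoc CG m_assoc)
  have type: "s (act a y) = s y" for a y by (simp add: s_def act_def)
  obtain I X :: "nat set" and inc t \<theta> where geo: "geometry I X inc t" "finite X" "\<theta> \<in> hom G (Aut_geometry X inc t)"
    and fixed: "\<forall>a\<in>carrier G. \<forall>b\<in>carrier G.
        (\<forall>J\<subseteq>I. card (fixed_flags X inc t J (\<theta> a)) = card (fixed_flags X inc t J (\<theta> b))) \<longrightarrow>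
        (\<forall>y\<in>Y. act a y = y \<longrightarrow> (\<exists>y'\<in>Y. s y' = s y \<and> act b y' = y'))"
    by (rule geometry_of_typed_action[where s = s and act = act, OF Y1 Y2 closed one mult type])
  have C_pow: "g [^] (k :: nat) \<in> C g" if "g \<in> carrier G" for g k
    using C[OF that] by blast
  have C_subgroup: "subgroup (C g) G" if "g \<in> carrier G" for g
    unfolding C_def by (rule generate_is_subgroup) (use that in simp)
  \<comment> \<open>\<open>g\<close> fixes \<open>C g\<close> itself, so \<open>h\<close> must fix
    some coset \<open>x <# C g\<close>, which puts \<open>inv x \<otimes> h \<otimes> x\<close> into
    \<open>C g\<close>.\<close>
  have power: "\<exists>x\<in>carrier G. \<exists>k :: nat. inv x \<otimes> h \<otimes> x = g [^] k"
    if g: "g \<in> carrier G" and h: "h \<in> carrier G"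
      and counts: "\<forall>J\<subseteq>I. card (fixed_flags X inc t J (\<theta> g)) = card (fixed_flags X inc t J (\<theta> h))" for g h
  proof -
    have "g <# C g = C g"
      using C_pow[OF g, of 1] g by (intro coset_join3 C_subgroup) simp_all
    then have "act g (g, C g) = (g, C g)" by (simp add: act_def)
    moreover have "C g \<in> (\<lambda>x. x <# C g) ` carrier G"
      using lcos_mult_one[OF CG[OF g]] by (intro image_eqI[of _ _ \<one>]) simp_all
    then have "(g, C g) \<in> Y" using g by (simp add: Y_def)
    ultimately obtain y where y: "y \<in> Y" "s y = s (g, C g)" "act h y = y"
      using bspec[OF bspec[OF fixed g] h] counts by blast
    then have "\<iota> (fst y) = \<iota> g" "fst y \<in> carrier G" by (auto simp: Y_def s_def)
    then have "fst y = g" using g by (rule inj_onD[OF \<iota>])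
    then obtain x where x: "x \<in> carrier G" "y = (g, x <# C g)" using y(1) by (auto simp: Y_def)
    have "(h \<otimes> x) \<otimes> \<one> \<in> (h \<otimes> x) <# C g"
      using subgroup.one_closed[OF C_subgroup[OF g]] unfolding l_coset_def by blast
    then have "h \<otimes> x \<in> (h \<otimes> x) <# C g" using h x(1) by simp
    also have "(h \<otimes> x) <# C g = x <# C g"
      using y(3) x h CG[OF g] by (simp add: act_def lcos_m_assoc)
    finally obtain c where c: "c \<in> C g" "h \<otimes> x = x \<otimes> c" by (auto simp: l_coset_def)
    have cG: "c \<in> carrier G" using c(1) CG[OF g] by blast
    have "inv x \<otimes> h \<otimes> x = inv x \<otimes> (x \<otimes> c)"
      using c(2) x(1) h by (simp add: m_assoc)
    also have "\<dots> = c" using cG x(1) by (simp flip: m_assoc)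
    finally show ?thesis using c(1) x(1) unfolding C[OF g] by blast
  qed
  have ord_dvd: "group.ord G h dvd group.ord G g"
    if g: "g \<in> carrier G" and h: "h \<in> carrier G" and x: "x \<in> carrier G"
      and eq: "inv x \<otimes> h \<otimes> x = g [^] k" for g h x and k :: nat
  proof -
    have "inv x \<otimes> h [^] group.ord G g \<otimes> x = (g [^] k) [^] group.ord G g"
      using conj_nat_pow[OF x h] eq by simp
    also have "\<dots> = (g [^] group.ord G g) [^] k"
      using g by (simp only: nat_pow_pow mult.commute)
    also have "\<dots> = \<one>" using g by simp
    finally have "x \<otimes> (inv x \<otimes> h [^] group.ord G g \<otimes> x) \<otimes> inv x = \<one>" using x by simp
    moreover have "x \<otimes> (inv x \<otimes> h [^] group.ord G g \<otimes> x) \<otimes> inv x = h [^] group.ord G g"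
      using x h by (simp add: m_assoc) (simp flip: m_assoc)
    ultimately show ?thesis using pow_eq_id[OF h] by simp
  qed
  have "flag_counts_separate_classes G I X inc t \<theta>"
    unfolding flag_counts_separate_classes_def
  proof (intro ballI impI)
    fix g h assume g: "g \<in> carrier G" and h: "h \<in> carrier G"
      and "\<forall>J. J \<subseteq> I \<longrightarrow> card (fixed_flags X inc t J (\<theta> g)) = card (fixed_flags X inc t J (\<theta> h))"
    then have counts: "\<forall>J\<subseteq>I. card (fixed_flags X inc t J (\<theta> g)) = card (fixed_flags X inc t J (\<theta> h))"
      "\<forall>J\<subseteq>I. card (fixed_flags X inc t J (\<theta> h)) = card (fixed_flags X inc t J (\<theta> g))" by simp_all
    obtain x and k :: nat where x: "x \<in> carrier G" and k: "inv x \<otimes> h \<otimes> x = g [^] k"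
      using power[OF g h counts(1)] by blast
    obtain y and l :: nat where y: "y \<in> carrier G" "inv y \<otimes> g \<otimes> y = h [^] l"
      using power[OF h g counts(2)] by blast
    have h_eq: "h = x \<otimes> g [^] k \<otimes> inv x"
      unfolding k[symmetric] using x h by (simp add: m_assoc) (simp flip: m_assoc)
    have gk: "g [^] k \<in> carrier G" using g by simp
    have "inv (inv x) \<otimes> g [^] k \<otimes> inv x = h [^] (1 :: nat)"
      using h_eq x h by simp
    then have "group.ord G (g [^] k) dvd group.ord G h"
      by (rule ord_dvd[OF h gk inv_closed[OF x]])
    moreover have "group.ord G h dvd group.ord G (g [^] k)"
      by (rule ord_dvd[OF gk h x, of 1]) (use k g in simp)
    moreover have "group.ord G h = group.ord G g"
      using ord_dvd[OF g h x k] ord_dvd[OF h g y] by (rule dvd_antisym)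
    ultimately have "group.ord G (g [^] k) = group.ord G g" by (metis dvd_antisym)
    \<comment> \<open>Since \<open>g [^] k\<close> has the same order as \<open>g\<close>, the order
      formula forces the gcd to be 1. If \<open>k = 0\<close>, the order of \<open>g\<close> is 1
      and the gcd is again 1.\<close>
    then have "(if k = 0 then 1 else group.ord G g div gcd (group.ord G g) k) = group.ord G g"
      using ord_pow_gen[OF g] by simp
    then have "gcd (group.ord G g) k = 1"
      using ord_ge_1[OF fin g] by (cases "k = 0") (auto simp: div_eq_dividend_iff)
    then have "coprime k (group.ord G g)"
      by (simp only: coprime_iff_gcd_eq_1 gcd.commute)
    then have "conjugate_in G g (g [^] k)"
      by (rule rational_group_conjugate_generator[OF fin rat g])
    moreover have "conjugate_in G (g [^] k) h"
      unfolding conjugate_in_def using h_eq x by blast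
    ultimately show "conjugate_in G g h"
      using g by (rule conjugate_in_trans)
  qed
  then show ?thesis using geo by blast
qed

end

text \<open>A formula cannot quantify over types, so the equivalence is stated for geometries on
  natural numbers, which suffice for existence because everything is finite. The second conjunct
  covers the direction that starts from a geometry over arbitrary types.\<close>

theorem theorem1p1:
  fixes G :: "('g, 'b) monoid_scheme"
  assumes "group G" and "finite (carrier G)"
  shows "(rational_group G \<longleftrightarrow>
           (\<exists>(I :: nat set) (X :: nat set) inc t \<theta>.
              geometry I X inc t \<and> finite X \<and> \<theta> \<in> hom G (Aut_geometry X inc t) \<and>
              flag_counts_separate_classes G I X inc t \<theta>))
       \<and> ((\<exists>(I :: 'i set) (X :: 'x set) inc t \<theta>.
              geometry I X inc t \<and> finite X \<and> \<theta> \<in> hom G (Aut_geometry X inc t) \<and>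
              flag_counts_separate_classes G I X inc t \<theta>)
           \<longrightarrow> rational_group G)"
proof (intro conjI iffI impI)
  show "\<exists>(I :: nat set) (X :: nat set) inc t \<theta>.
      geometry I X inc t \<and> finite X \<and> \<theta> \<in> hom G (Aut_geometry X inc t) \<and>
      flag_counts_separate_classes G I X inc t \<theta>" if "rational_group G"
    by (rule group.rational_group_imp_separating_geometry[OF assms that])
qed (blast intro: group.flag_counts_imp_rational_group[OF assms])+

end
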